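(* Let $\Phi_B=\Phi_P\circ\Phi_S$ be a BITR model (defined in the context), with arbitrary values of all its learnable weights and arbitrary radial functions. For a pair of 3-D point clouds $(X,Y)$ let $\hat r(X,Y)\in\mathbb{R}^{3\times 3}$ denote the matrix to which the SVD projection is applied in $\Phi_P$. Assume that the singular values $\sigma_1,\sigma_2,\sigma_3$ of $\hat r(X,Y)$ satisfy $\sigma_1\ge\sigma_2>\sigma_3\ge 0$. Then $\Phi_B$ is $SE(3)$-bi-equivariant, i.e. for all $g_1,g_2\in SE(3)$, $$\Phi_B(g_1X,g_2Y)=g_2\,\Phi_B(X,Y)\,g_1^{-1}.$$
   Context: **Conventions.** A 3-D point cloud (PC) is a finite indexed family of points of $\mathbb{R}^3$ (possibly with features, see below). An element $g=(r,t)\in SE(3)$, $r\in SO(3)$, $t\in\mathbb{R}^3$, acts by $gx=rx+t$ and $gX=\{gx_u\}_u$. $\|\cdot\|$ is the Euclidean norm, $\oplus$ is concatenation, $\otimes$ is the Kronecker product, $\mathrm{vec}$ stacks the columns of a matrix and $\mathrm{unvec}$ is its inverse, $\boldsymbol m(\cdot)$ is the mean of a PC, $\mathrm{Pool}_u$ is the average over the index $u$. **Representations.** $\rho_p$ ($p\in\mathbb{N}$) is the real orthogonal irreducible representation of $SO(3)$ of dimension $2p+1$, with $\rho_0=1$ and $\rho_1(r)=r$. $\rho_{p,q}(r_1\times r_2)=\rho_p(r_1)\otimes\rho_q(r_2)$. $Y_J$ is the vector of real spherical harmonics of degree $J$, so $Y_J(rx)=\rho_J(r)Y_J(x)$ for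 $\|x\|=1$; by convention $Y_J(x/\|x\|)$ for $x=0$ means $0$ if $J>0$ and the constant $Y_0$ if $J=0$. For $|i-o|\le J\le i+o$, $C_J^{i,o}\in\mathbb{R}^{(2i+1)(2o+1)\times(2J+1)}$ is a fixed real Clebsch–Gordan matrix: $(\rho_i(r)\otimes\rho_o(r))C_J^{i,o}=C_J^{i,o}\rho_J(r)$, with entries $\langle i,m,o,m'|J,m''\rangle$. For $\boldsymbol o=(o_1,o_2)$, $\boldsymbol i=(i_1,i_2)\in\mathbb{N}^2$, the second-order Clebsch–Gordan matrix $\mathcal{Q}^{\boldsymbol o,\boldsymbol i}_{J_1,J_2}$ has rows indexed by $(m_1,m_2,m_3,m_4)$, columns by $(m_5,m_6)$, and entries $\langle i_1,m_1,o_1,m_3|J_1,m_5\rangle\langle i_2,m_2,o_2,m_4|J_2,m_6\rangle$. **6-D tensor fields.** A field $f$ is a finite indexed family of points $z_u\in\mathbb{R}^6$, $u=1,\dots,L$, with features $f_u=\bigoplus_{\boldsymbol i,b}f^{\boldsymbol i,b}(z_u)$, $f^{\boldsymbol i,b}(z_u)\in\mathbb{R}^{(2i_1+1)(2i_2+1)}$, $\boldsymbol i$ ranging over a finite set of degrees in $\mathbb{N}^2$ and $b$ over channels. $F^{\boldsymbol i}(z_u)$ is the matrix whose rows are the channels $f^{\boldsymbol i,b}(z_u)$. Write $z=z^1\oplus z^2$ with $z^1,z^2\in\mathbb{R}^3$. $g_1\times g_2\in SE(3)\times SE(3)$ acts by $z\mapsto g_1z^1\oplus g_2z^2$ on points and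 by $\rho_{\boldsymbol i}(r_1\times r_2)$ on degree-$\boldsymbol i$ features: $((g_1\times g_2)f)^{\boldsymbol i}(z)=\rho_{\boldsymbol i}(r_1\times r_2)f^{\boldsymbol i}((g_1\times g_2)^{-1}z)$. **$SE(3)\times SE(3)$-transformer layer.** It keeps the points $z_u$ and sends $f_{in}$ to $f_{out}$, where for each output degree $\boldsymbol o$ and output channel $a$ $$f_{out}^{\boldsymbol o,a}(z_u)=W^{\boldsymbol o,a}F_{in}^{\boldsymbol o}(z_u)+\sum_{v\in KNN(u)\setminus\{u\}}\alpha_{uv}\sum_{\boldsymbol i,b}\mathcal{W}_V^{\boldsymbol o,\boldsymbol i,a,b}(z_v-z_u)f_{in}^{\boldsymbol i,b}(z_v),$$ the first term being absent if $f_{in}$ has no degree-$\boldsymbol o$ feature. $W^{\boldsymbol o,a}$ is a row vector of weights. $KNN(u)$ is the set of indices of the $k$ nearest points to $z_u$ in Euclidean distance of $\mathbb{R}^6$, ties broken by index. The attention is $\alpha_{uv}=\exp(\mathbf{Q}_u^\top\mathbf{K}_{uv})/\sum_{v'\in KNN(u)\setminus\{u\}}\exp(\mathbf{Q}_u^\top\mathbf{K}_{uv'})$, with $\mathbf{Q}_u=\bigoplus_{\boldsymbol o}W_Q^{\boldsymbol o}F_{in}^{\boldsymbol o}(z_u)$ and $\mathbf{K}_{uv}=\bigoplus_{\boldsymbol o}\sum_{\boldsymbol i,b}\mathcal{W}_K^{\boldsymbol o,\boldsymbol i,b}(z_v-z_u)f_{in}^{\boldsymbol i,b}(z_v)$,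 $\boldsymbol o$ ranging over the input degrees and $W_Q^{\boldsymbol o}$ a row vector of weights. Every kernel ($\mathcal{W}_K$ or $\mathcal{W}_V$, each channel index) is a $(2o_1+1)(2o_2+1)\times(2i_1+1)(2i_2+1)$ matrix of the form $$\mathrm{vec}(\mathcal{W}^{\boldsymbol o,\boldsymbol i}(z))=\sum_{J_1=|o_1-i_1|}^{o_1+i_1}\ \sum_{J_2=|o_2-i_2|}^{o_2+i_2}\varphi^{\boldsymbol o,\boldsymbol i}_{J_1,J_2}(\|z^1\|,\|z^2\|)\,\mathcal{Q}^{\boldsymbol o,\boldsymbol i}_{J_1,J_2}\Bigl(Y_{J_1}\bigl(\tfrac{z^1}{\|z^1\|}\bigr)\otimes Y_{J_2}\bigl(\tfrac{z^2}{\|z^2\|}\bigr)\Bigr),$$ with arbitrary radial functions $\varphi:\mathbb{R}\times\mathbb{R}\to\mathbb{R}$ (one for each kernel, channel index and $J_1,J_2$). **Elu layer.** Pointwise, on each degree $\boldsymbol i$ with $c$ channels: $F_\mu=W_\mu^{\boldsymbol i}F^{\boldsymbol i}$, $F_\nu=W_\nu^{\boldsymbol i}F^{\boldsymbol i}$ with $W_\mu^{\boldsymbol i},W_\nu^{\boldsymbol i}\in\mathbb{R}^{c\times c}$; each output channel equals $F_\mu$ if $\langle F_\mu,F_\nu\rangle\ge 0$ and $F_\mu-\langle F_\mu,\frac{F_\nu}{\|F_\nu\|}\rangle\frac{F_\nu}{\|F_\nu\|}$ otherwise (inner product and norm taken channel by channel). An $SE(3)\times SE(3)$-transformer is a composition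 of transformer layers and Elu layers. **$SE(3)$-transformer.** Defined by the same formulas for fields on points $x_u\in\mathbb{R}^3$ with features of degree $p\in\mathbb{N}$ transforming by $\rho_p$, neighborhoods in $\mathbb{R}^3$, and kernels $\mathrm{vec}(\mathcal{W}^{l,k}(x))=\sum_{J=|k-l|}^{k+l}\varphi_J^{l,k}(\|x\|)\,C_J^{k,l}\,Y_J(x/\|x\|)$, with the analogous Elu layers. **BITR.** Input: PCs $X=\{x_u\}_{u=1}^M$, $Y=\{y_v\}_{v=1}^N$, each carrying input features that are transported equivariantly (on $gX$, a degree-$p$ feature is multiplied by $\rho_p(r)$; e.g. constant degree-0 features or normal vectors). 1. *Point cloud merge.* A shared $SE(3)$-transformer $\Phi_E$ is applied to $X$ and to $Y$, all intermediate features having degree $0$ or $1$. Just before its last layer the features are fused: $f_X(x_u)\leftarrow f_X^0(x_u)\oplus\mathrm{Pool}_v(f_Y^0(y_v))\oplus f_X^1(x_u)$ and $f_Y(y_v)\leftarrow f_Y^0(y_v)\oplus\mathrm{Pool}_u(f_X^0(x_u))\oplus f_Y^1(y_v)$. The outputs are degree-$0$ features with $L$ channels, $F_X^0\in\mathbb{R}^{L\times M}$, $F_Y^0\in\mathbb{R}^{L\times N}$. The key points are the rows of $\tilde X=\mathrm{SoftMax}(F_X^0)X$ and $\tilde Y=\mathrm{SoftMax}(F_Y^0)Y$ (row-wise softmax; $X\in\mathbb{R}^{M\times3}$, $Y\in\mathbb{R}^{N\times 3}$ the coordinate matrices). Put $z_u=\tilde x_u\oplus\tilde y_u\in\mathbb{R}^6$,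 $u=1,\dots,L$. 2. *Feature extraction.* An $SE(3)\times SE(3)$-transformer is applied to a field on $Z=\{z_u\}$ whose input features are transported equivariantly under $(X,Y)\mapsto(g_1X,g_2Y)$ (e.g. constant degree-$(0,0)$ features). Its output field $f$ has one channel in each of the degrees $(1,1),(1,0),(0,1)$. Steps 1–2 define $\Phi_S(X,Y)=f$. 3. *Projection $\Phi_P$.* $\tilde r=\mathrm{Pool}_u(f_u^{1,1})\in\mathbb{R}^9$, $\hat r=\mathrm{unvec}(\tilde r)\in\mathbb{R}^{3\times3}$, $t_X=\mathrm{Pool}_u(f_u^{1,0})$, $t_Y=\mathrm{Pool}_u(f_u^{0,1})$; the output is $(r,t)$ with $r=\mathrm{SVD}(\hat r)$ and $t=(\boldsymbol m(\tilde Y)+t_Y)-r(\boldsymbol m(\tilde X)+t_X)$. **SVD projection.** If $A=\hat U\hat\Sigma\hat V^T$ is a singular value decomposition with $\hat U,\hat V\in O(3)$, $\hat\Sigma=\mathrm{diag}(\sigma_1,\sigma_2,\sigma_3)$, $\sigma_1\ge\sigma_2\ge\sigma_3\ge0$, then $\mathrm{SVD}(A)=\hat U\,\mathrm{diag}(1,1,\mathrm{sign}\det(\hat U\hat V^T))\,\hat V^T\in SO(3)$; this does not depend on the chosen decomposition when $\sigma_2>\sigma_3$. *)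

theory Defs
  imports "HOL-Analysis.Analysis" "Jordan_Normal_Form.Matrix"
begin

text \<open>
  Points live in \<^typ>\<open>real^3\<close> and \<^typ>\<open>(real^3) \<times> (real^3)\<close>; the norm of the
  product type is the Euclidean norm of the 6-dimensional space. Features and kernels, whose
  dimension depends on their degree, are vectors and matrices of Jordan Normal Form, 0-indexed.
\<close>

hide_const (open) Finite_Cartesian_Product.vec Finite_Cartesian_Product.mat
hide_type (open) Finite_Cartesian_Product.vec
no_notation vec_index (infixl \<open>$\<close> 100)
no_notation scalar_prod (infix \<open>\<bullet>\<close> 70)
notation vec_index (infixl \<open>$v\<close> 100)
notation scalar_prod (infix \<open>\<bullet>v\<close> 70)


section \<open>Linear algebra\<close>

definition vsum :: "nat \<Rightarrow> ('k \<Rightarrow> real vec) \<Rightarrow> 'k set \<Rightarrow> real vec" where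
  "vsum n f A = vec n (\<lambda>m. \<Sum>x\<in>A. f x $v m)"

definition vnorm :: "real vec \<Rightarrow> real" where
  "vnorm v = sqrt (v \<bullet>v v)"

definition kron :: "real mat \<Rightarrow> real mat \<Rightarrow> real mat" where
  "kron A B = mat (dim_row A * dim_row B) (dim_col A * dim_col B)
     (\<lambda>(i, j). A $$ (i div dim_row B, j div dim_col B) * B $$ (i mod dim_row B, j mod dim_col B))"

definition vkron :: "real vec \<Rightarrow> real vec \<Rightarrow> real vec" where
  "vkron v w = vec (dim_vec v * dim_vec w) (\<lambda>k. v $v (k div dim_vec w) * w $v (k mod dim_vec w))"

text \<open>Inverse of the column-stacking vectorisation of matrices of size \<open>nr \<times> nc\<close>.\<close>
definition unvec :: "nat \<Rightarrow> nat \<Rightarrow> real vec \<Rightarrow> real mat" where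
  "unvec nr nc v = mat nr nc (\<lambda>(i, j). v $v (j * nr + i))"

definition coord :: "3 \<Rightarrow> nat" where
  "coord i = (if i = 1 then 0 else if i = 2 then 1 else 2)"

definition to_R3 :: "real vec \<Rightarrow> real^3" where
  "to_R3 v = (\<chi> i. v $v coord i)"

definition to_R33 :: "real mat \<Rightarrow> real^3^3" where
  "to_R33 A = (\<chi> i j. A $$ (coord i, coord j))"


section \<open>The group \<open>SE(3)\<close>\<close>

definition SO3 :: "(real^3^3) set" where
  "SO3 = {r. rotation_matrix r}"

type_synonym motion = "(real^3^3) \<times> (real^3)"

definition SE3 :: "motion set" where
  "SE3 = SO3 \<times> UNIV"

fun move :: "motion \<Rightarrow> real^3 \<Rightarrow> real^3" where
  "move (r, t) x = r *v x + t"

fun se3_mult :: "motion \<Rightarrow> motion \<Rightarrow> motion" where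
  "se3_mult (r, t) (r', t') = (r ** r', r *v t' + t)"

fun se3_inv :: "motion \<Rightarrow> motion" where
  "se3_inv (r, t) = (matrix_inv r, - (matrix_inv r *v t))"


section \<open>Representations, spherical harmonics, Clebsch--Gordan matrices\<close>

text \<open>
  The paper fixes the bases of the irreducible representations only through \<open>\<rho>\<^sub>1(r) = r\<close> and
  \<open>Y\<^sub>J(rx) = \<rho>\<^sub>J(r) Y\<^sub>J(x)\<close>. Accordingly \<open>\<rho>\<close>, \<open>Y\<close> and the Clebsch--Gordan matrices are
  arbitrary families subject to the defining properties below.
\<close>

definition SO3_irreducible :: "nat \<Rightarrow> (real^3^3 \<Rightarrow> real mat) \<Rightarrow> bool" where
  "SO3_irreducible n R \<longleftrightarrow> n > 0 \<and>
     (\<forall>S \<subseteq> carrier_vec n.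
        0\<^sub>v n \<in> S \<and> (\<forall>v\<in>S. \<forall>w\<in>S. v + w \<in> S) \<and> (\<forall>c. \<forall>v\<in>S. c \<cdot>\<^sub>v v \<in> S) \<and>
        (\<forall>r\<in>SO3. \<forall>v\<in>S. R r *\<^sub>v v \<in> S)
        \<longrightarrow> S = {0\<^sub>v n} \<or> S = carrier_vec n)"

definition SO3_orthogonal_rep :: "nat \<Rightarrow> (real^3^3 \<Rightarrow> real mat) \<Rightarrow> bool" where
  "SO3_orthogonal_rep n R \<longleftrightarrow>
     (\<forall>r\<in>SO3. R r \<in> carrier_mat n n \<and> R r * transpose_mat (R r) = 1\<^sub>m n) \<and>
     (\<forall>r\<in>SO3. \<forall>s\<in>SO3. R (r ** s) = R r * R s) \<and>
     (\<forall>i<n. \<forall>j<n. continuous_on SO3 (\<lambda>r. R r $$ (i, j)))"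

definition SO3_irreps :: "(nat \<Rightarrow> real^3^3 \<Rightarrow> real mat) \<Rightarrow> bool" where
  "SO3_irreps rho \<longleftrightarrow>
     (\<forall>p. SO3_orthogonal_rep (2 * p + 1) (rho p) \<and> SO3_irreducible (2 * p + 1) (rho p)) \<and>
     (\<forall>r\<in>SO3. rho 0 r = 1\<^sub>m 1) \<and>
     (\<forall>r\<in>SO3. to_R33 (rho 1 r) = r)"

definition harmonic_form :: "nat \<Rightarrow> (real^3 \<Rightarrow> real) \<Rightarrow> bool" where
  "harmonic_form J h \<longleftrightarrow> real_polynomial_function h \<and>
     (\<forall>c x. h (c *\<^sub>R x) = c ^ J * h x) \<and>
     (\<forall>x. (\<Sum>i\<in>UNIV. (deriv ^^ 2) (\<lambda>s. h (x + s *\<^sub>R axis i 1)) 0) = 0)"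

text \<open>
  The \<open>2J + 1\<close> components of \<open>Y\<^sub>J\<close> are linearly independent spherical harmonics of degree \<open>J\<close>.
  As \<open>\<rho>\<^sub>J\<close> is orthogonal and irreducible, the equivariance makes them orthonormal in \<open>L\<^sup>2\<close> of the
  sphere up to one common factor, so only the normalisation convention is left open.
  The values of \<open>Y\<^sub>J\<close> off the unit sphere are irrelevant.
\<close>
definition spherical_harmonics ::
    "(nat \<Rightarrow> real^3^3 \<Rightarrow> real mat) \<Rightarrow> (nat \<Rightarrow> real^3 \<Rightarrow> real vec) \<Rightarrow> bool" where
  "spherical_harmonics rho Y \<longleftrightarrow>
     (\<forall>J. \<forall>x. norm x = 1 \<longrightarrow> Y J x \<in> carrier_vec (2 * J + 1)) \<and>
     (\<forall>J. \<forall>m < 2 * J + 1. \<exists>h. harmonic_form J h \<and> (\<forall>x. norm x = 1 \<longrightarrow> Y J x $v m = h x)) \<and>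
     (\<forall>J. \<forall>c. (\<forall>x. norm x = 1 \<longrightarrow> (\<Sum>m < 2 * J + 1. c m * Y J x $v m) = 0)
        \<longrightarrow> (\<forall>m < 2 * J + 1. c m = 0)) \<and>
     (\<forall>J. \<forall>r\<in>SO3. \<forall>x. norm x = 1 \<longrightarrow> Y J (r *v x) = rho J r *\<^sub>v Y J x)"

text \<open>\<open>Y\<^sub>J(x / \<parallel>x\<parallel>)\<close>, with its convention at \<open>x = 0\<close>; \<open>Y\<^sub>0\<close> is constant on the unit sphere.\<close>
definition Y_dir :: "(nat \<Rightarrow> real^3 \<Rightarrow> real vec) \<Rightarrow> nat \<Rightarrow> real^3 \<Rightarrow> real vec" where
  "Y_dir Y J x =
     (if x \<noteq> 0 then Y J (x /\<^sub>R norm x)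
      else if J = 0 then Y 0 (axis 1 1) else 0\<^sub>v (2 * J + 1))"

definition tri :: "nat \<Rightarrow> nat \<Rightarrow> nat set" where
  "tri i l = {nat \<bar>int i - int l\<bar> .. i + l}"

text \<open>
  \<open>CG i l J\<close> is the matrix \<open>C\<^sub>J\<close> with upper indices \<open>i, l\<close>: a nonzero intertwiner (unique up to a
  factor). Its entry \<open>\<langle>i, m, l, m' | J, m''\<rangle>\<close> is at row \<open>m (2l + 1) + m'\<close>, column \<open>m''\<close>.
\<close>
definition clebsch_gordan ::
    "(nat \<Rightarrow> real^3^3 \<Rightarrow> real mat) \<Rightarrow> (nat \<Rightarrow> nat \<Rightarrow> nat \<Rightarrow> real mat) \<Rightarrow> bool" where
  "clebsch_gordan rho CG \<longleftrightarrow> (\<forall>i l. \<forall>J \<in> tri i l.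
     CG i l J \<in> carrier_mat ((2 * i + 1) * (2 * l + 1)) (2 * J + 1) \<and>
     CG i l J \<noteq> 0\<^sub>m ((2 * i + 1) * (2 * l + 1)) (2 * J + 1) \<and>
     (\<forall>r\<in>SO3. kron (rho i r) (rho l r) * CG i l J = CG i l J * rho J r))"

definition cg_entry ::
    "(nat \<Rightarrow> nat \<Rightarrow> nat \<Rightarrow> real mat) \<Rightarrow> nat \<Rightarrow> nat \<Rightarrow> nat \<Rightarrow> nat \<Rightarrow> nat \<Rightarrow> nat \<Rightarrow> real" where
  "cg_entry CG i m l m' J m'' = CG i l J $$ (m * (2 * l + 1) + m', m'')"

fun dim3 :: "nat \<Rightarrow> nat" where
  "dim3 p = 2 * p + 1"

fun dim6 :: "nat \<times> nat \<Rightarrow> nat" where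
  "dim6 (p, q) = (2 * p + 1) * (2 * q + 1)"

text \<open>
  Second-order Clebsch--Gordan matrix. Its row \<open>(m\<^sub>1, m\<^sub>2, m\<^sub>3, m\<^sub>4)\<close> has number
  \<open>a * dim6 (o1, o2) + b\<close> with \<open>a = m\<^sub>1 (2 i2 + 1) + m\<^sub>2\<close> and \<open>b = m\<^sub>3 (2 o2 + 1) + m\<^sub>4\<close>.
\<close>
fun cg2 :: "(nat \<Rightarrow> nat \<Rightarrow> nat \<Rightarrow> real mat) \<Rightarrow> nat \<times> nat \<Rightarrow> nat \<times> nat \<Rightarrow> nat \<Rightarrow> nat \<Rightarrow> real mat" where
  "cg2 CG (o1, o2) (i1, i2) J1 J2 =
     mat (dim6 (i1, i2) * dim6 (o1, o2)) (dim6 (J1, J2))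
       (\<lambda>(row, col).
          let a = row div dim6 (o1, o2); b = row mod dim6 (o1, o2);
              m1 = a div (2 * i2 + 1); m2 = a mod (2 * i2 + 1);
              m3 = b div (2 * o2 + 1); m4 = b mod (2 * o2 + 1);
              m5 = col div (2 * J2 + 1); m6 = col mod (2 * J2 + 1)
          in cg_entry CG i1 m1 o1 m3 J1 m5 * cg_entry CG i2 m2 o2 m4 J2 m6)"


section \<open>Tensor fields\<close>

text \<open>
  \<open>feat F u d b\<close> is the channel \<open>b < chan F d\<close> of the degree-\<open>d\<close> feature at the point \<open>pt F u\<close>,
  \<open>u < num F\<close>; values at other arguments are irrelevant. The same type, with degrees \<^typ>\<open>'d\<close>
  in \<^typ>\<open>nat\<close> or \<^typ>\<open>nat \<times> nat\<close>, serves for point clouds and for 6-D fields.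
\<close>
record ('p, 'd) tfield =
  num :: nat
  pt :: "nat \<Rightarrow> 'p"
  chan :: "'d \<Rightarrow> nat"
  feat :: "nat \<Rightarrow> 'd \<Rightarrow> nat \<Rightarrow> real vec"

type_synonym cloud = "(real^3, nat) tfield"
type_synonym field6 = "((real^3) \<times> (real^3), nat \<times> nat) tfield"

definition degs :: "('d \<Rightarrow> nat) \<Rightarrow> 'd set" where
  "degs c = {d. c d \<noteq> 0}"

definition well_formed :: "('d \<Rightarrow> nat) \<Rightarrow> ('p, 'd) tfield \<Rightarrow> bool" where
  "well_formed dm F \<longleftrightarrow> finite (degs (chan F)) \<and>
     (\<forall>u < num F. \<forall>d. \<forall>b < chan F d. feat F u d b \<in> carrier_vec (dm d))"

definition act_cloud ::
    "(nat \<Rightarrow> real^3^3 \<Rightarrow> real mat) \<Rightarrow> motion \<Rightarrow> cloud \<Rightarrow> cloud" where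
  "act_cloud rho g F = F\<lparr>
     pt := \<lambda>u. move g (pt F u),
     feat := \<lambda>u p b. rho p (fst g) *\<^sub>v feat F u p b\<rparr>"

fun rho2 :: "(nat \<Rightarrow> real^3^3 \<Rightarrow> real mat) \<Rightarrow> nat \<times> nat \<Rightarrow> real^3^3 \<Rightarrow> real^3^3 \<Rightarrow> real mat" where
  "rho2 rho (p, q) r1 r2 = kron (rho p r1) (rho q r2)"

definition pool :: "nat \<Rightarrow> nat \<Rightarrow> (nat \<Rightarrow> real vec) \<Rightarrow> real vec" where
  "pool n N f = (1 / real N) \<cdot>\<^sub>v vsum n f {..<N}"

definition mean :: "nat \<Rightarrow> (nat \<Rightarrow> real^3) \<Rightarrow> real^3" where
  "mean N x = (\<Sum>u<N. x u) /\<^sub>R real N"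


section \<open>Transformers\<close>

definition knn :: "nat \<Rightarrow> nat \<Rightarrow> (nat \<Rightarrow> 'p::metric_space) \<Rightarrow> nat \<Rightarrow> nat set" where
  "knn k N z u = {v. v < N \<and>
     card {w. w < N \<and> (dist (z w) (z u) < dist (z v) (z u) \<or>
                        dist (z w) (z u) = dist (z v) (z u) \<and> w < v)} < k}"

text \<open>
  \<open>Attention k c W WQ phiK phiV\<close>: neighbourhood size \<open>k\<close>, output channel numbers \<open>c\<close>, self-interaction
  weights \<open>W o a b\<close> and query weights \<open>WQ o b\<close> (entry \<open>b\<close> of the row vectors), and radial functions
  \<open>phiK o i b\<close>, \<open>phiV o i a b\<close> of the key and value kernels.
  \<open>Elu Wmu Wnu\<close>: the weight matrices have entries \<open>Wmu d a b\<close>, \<open>Wnu d a b\<close>.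
\<close>
datatype ('d, 'r) layer =
    Attention nat "'d \<Rightarrow> nat" "'d \<Rightarrow> nat \<Rightarrow> nat \<Rightarrow> real" "'d \<Rightarrow> nat \<Rightarrow> real"
      "'d \<Rightarrow> 'd \<Rightarrow> nat \<Rightarrow> 'r" "'d \<Rightarrow> 'd \<Rightarrow> nat \<Rightarrow> nat \<Rightarrow> 'r"
  | Elu "'d \<Rightarrow> nat \<Rightarrow> nat \<Rightarrow> real" "'d \<Rightarrow> nat \<Rightarrow> nat \<Rightarrow> real"

text \<open>Row vector of weights \<open>w\<close> times the matrix whose rows are the channels at point \<open>u\<close>.\<close>
definition mix :: "('d \<Rightarrow> nat) \<Rightarrow> (nat \<Rightarrow> real) \<Rightarrow> ('p, 'd) tfield \<Rightarrow> nat \<Rightarrow> 'd \<Rightarrow> real vec" where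
  "mix dm w F u d = vsum (dm d) (\<lambda>b. w b \<cdot>\<^sub>v feat F u d b) {..<chan F d}"

text \<open>\<open>ker \<phi> d i z\<close> is the kernel with radial functions \<open>\<phi>\<close>, output degree \<open>d\<close>, input degree \<open>i\<close>.\<close>
definition message ::
    "('d \<Rightarrow> nat) \<Rightarrow> ('r \<Rightarrow> 'd \<Rightarrow> 'd \<Rightarrow> 'p \<Rightarrow> real mat) \<Rightarrow> ('d \<Rightarrow> nat \<Rightarrow> 'r) \<Rightarrow>
     ('p::real_normed_vector, 'd) tfield \<Rightarrow> 'd \<Rightarrow> nat \<Rightarrow> nat \<Rightarrow> real vec" where
  "message dm ker phi F d u v =
     vsum (dm d) (\<lambda>(i, b). ker (phi i b) d i (pt F v - pt F u) *\<^sub>v feat F v i b)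
       (SIGMA i:degs (chan F). {..<chan F i})"

text \<open>
  \<open>Q\<^sub>u\<^sup>T K\<^sub>u\<^sub>v\<close>; the inner product of two concatenations is the sum of the blockwise inner products.
\<close>
definition logit ::
    "('d \<Rightarrow> nat) \<Rightarrow> ('r \<Rightarrow> 'd \<Rightarrow> 'd \<Rightarrow> 'p \<Rightarrow> real mat) \<Rightarrow> ('d \<Rightarrow> nat \<Rightarrow> real) \<Rightarrow>
     ('d \<Rightarrow> 'd \<Rightarrow> nat \<Rightarrow> 'r) \<Rightarrow> ('p::real_normed_vector, 'd) tfield \<Rightarrow> nat \<Rightarrow> nat \<Rightarrow> real" where
  "logit dm ker WQ phiK F u v =
     (\<Sum>d\<in>degs (chan F). mix dm (WQ d) F u d \<bullet>v message dm ker (phiK d) F d u v)"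

definition elu :: "real vec \<Rightarrow> real vec \<Rightarrow> real vec" where
  "elu Fmu Fnu =
     (if Fmu \<bullet>v Fnu \<ge> 0 then Fmu
      else let e = (1 / vnorm Fnu) \<cdot>\<^sub>v Fnu in Fmu - (Fmu \<bullet>v e) \<cdot>\<^sub>v e)"

fun apply_layer ::
    "('d \<Rightarrow> nat) \<Rightarrow> ('r \<Rightarrow> 'd \<Rightarrow> 'd \<Rightarrow> 'p \<Rightarrow> real mat) \<Rightarrow> ('d, 'r) layer \<Rightarrow>
     ('p::real_normed_vector, 'd) tfield \<Rightarrow> ('p, 'd) tfield" where
  "apply_layer dm ker (Attention k c W WQ phiK phiV) F =
     (let nb = (\<lambda>u. knn k (num F) (pt F) u - {u});
          s = logit dm ker WQ phiK F;
          alpha = (\<lambda>u v. exp (s u v) / (\<Sum>v'\<in>nb u. exp (s u v')))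
      in F\<lparr>chan := c,
           feat := \<lambda>u d a. mix dm (W d a) F u d +
             vsum (dm d) (\<lambda>v. alpha u v \<cdot>\<^sub>v message dm ker (\<lambda>i b. phiV d i a b) F d u v) (nb u)\<rparr>)"
| "apply_layer dm ker (Elu Wmu Wnu) F =
     F\<lparr>feat := \<lambda>u d a. elu (mix dm (Wmu d a) F u d) (mix dm (Wnu d a) F u d)\<rparr>"

definition transformer ::
    "('d \<Rightarrow> nat) \<Rightarrow> ('r \<Rightarrow> 'd \<Rightarrow> 'd \<Rightarrow> 'p \<Rightarrow> real mat) \<Rightarrow> ('d, 'r) layer list \<Rightarrow>
     ('p::real_normed_vector, 'd) tfield \<Rightarrow> ('p, 'd) tfield" where
  "transformer dm ker = fold (apply_layer dm ker)"

text \<open>Channel numbers after a layer, as a function of those before it.\<close>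
fun out_chan :: "('d, 'r) layer \<Rightarrow> ('d \<Rightarrow> nat) \<Rightarrow> ('d \<Rightarrow> nat)" where
  "out_chan (Attention k c W WQ phiK phiV) c0 = c"
| "out_chan (Elu Wmu Wnu) c0 = c0"

fun finite_layer :: "('d, 'r) layer \<Rightarrow> bool" where
  "finite_layer (Attention k c W WQ phiK phiV) \<longleftrightarrow> finite (degs c)"
| "finite_layer (Elu Wmu Wnu) \<longleftrightarrow> True"

type_synonym layer3 = "(nat, nat \<Rightarrow> real \<Rightarrow> real) layer"
type_synonym layer6 = "(nat \<times> nat, nat \<Rightarrow> nat \<Rightarrow> real \<Rightarrow> real \<Rightarrow> real) layer"

definition kernel3 ::
    "(nat \<Rightarrow> real^3 \<Rightarrow> real vec) \<Rightarrow> (nat \<Rightarrow> nat \<Rightarrow> nat \<Rightarrow> real mat) \<Rightarrow>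
     (nat \<Rightarrow> real \<Rightarrow> real) \<Rightarrow> nat \<Rightarrow> nat \<Rightarrow> real^3 \<Rightarrow> real mat" where
  "kernel3 Y CG phi l k x = unvec (dim3 l) (dim3 k)
     (vsum (dim3 k * dim3 l)
        (\<lambda>J. phi J (norm x) \<cdot>\<^sub>v (CG k l J *\<^sub>v Y_dir Y J x)) (tri k l))"

definition kernel6 ::
    "(nat \<Rightarrow> real^3 \<Rightarrow> real vec) \<Rightarrow> (nat \<Rightarrow> nat \<Rightarrow> nat \<Rightarrow> real mat) \<Rightarrow>
     (nat \<Rightarrow> nat \<Rightarrow> real \<Rightarrow> real \<Rightarrow> real) \<Rightarrow> nat \<times> nat \<Rightarrow> nat \<times> nat \<Rightarrow> (real^3) \<times> (real^3) \<Rightarrow> real mat" where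
  "kernel6 Y CG phi d i z = unvec (dim6 d) (dim6 i)
     (vsum (dim6 i * dim6 d)
        (\<lambda>(J1, J2). phi J1 J2 (norm (fst z)) (norm (snd z)) \<cdot>\<^sub>v
           (cg2 CG d i J1 J2 *\<^sub>v vkron (Y_dir Y J1 (fst z)) (Y_dir Y J2 (snd z))))
        (tri (fst d) (fst i) \<times> tri (snd d) (snd i)))"


section \<open>BITR\<close>

text \<open>
  \<open>key_feat X Y u d b\<close> is the input feature of the 6-D field at the \<open>u\<close>-th pair of key points.
\<close>
record bitr =
  in_chan :: "nat \<Rightarrow> nat"
  enc_layers :: "layer3 list"
  enc_last :: layer3
  nkeys :: nat
  key_chan :: "nat \<times> nat \<Rightarrow> nat"
  key_feat :: "cloud \<Rightarrow> cloud \<Rightarrow> nat \<Rightarrow> nat \<times> nat \<Rightarrow> nat \<Rightarrow> real vec"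
  layers6 :: "layer6 list"

definition valid_input :: "bitr \<Rightarrow> cloud \<Rightarrow> bool" where
  "valid_input B X \<longleftrightarrow> num X > 0 \<and> chan X = in_chan B \<and> well_formed dim3 X"

definition fuse_chan :: "(nat \<Rightarrow> nat) \<Rightarrow> (nat \<Rightarrow> nat) \<Rightarrow> (nat \<Rightarrow> nat)" where
  "fuse_chan c c' = (\<lambda>p. if p = 0 then c 0 + c' 0 else if p = 1 then c 1 else 0)"

definition fuse :: "cloud \<Rightarrow> cloud \<Rightarrow> cloud" where
  "fuse F G = F\<lparr>
     chan := fuse_chan (chan F) (chan G),
     feat := \<lambda>u p b.
       if p = 0 \<and> b \<ge> chan F 0
       then pool 1 (num G) (\<lambda>v. feat G v 0 (b - chan F 0))
       else feat F u p b\<rparr>"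

definition encode ::
    "(nat \<Rightarrow> real^3 \<Rightarrow> real vec) \<Rightarrow> (nat \<Rightarrow> nat \<Rightarrow> nat \<Rightarrow> real mat) \<Rightarrow> bitr \<Rightarrow> cloud \<Rightarrow> cloud \<Rightarrow> cloud" where
  "encode Y CG B P P' =
     apply_layer dim3 (kernel3 Y CG) (enc_last B)
       (fuse (transformer dim3 (kernel3 Y CG) (enc_layers B) P)
             (transformer dim3 (kernel3 Y CG) (enc_layers B) P'))"

text \<open>
  Row \<open>u\<close> of \<open>SoftMax(F\<^sup>0) X\<close>, where \<open>F\<^sup>0\<close> has the degree-0 channels as rows and the points as columns.
\<close>
definition key_point :: "cloud \<Rightarrow> nat \<Rightarrow> real^3" where
  "key_point E u =
     (let s = (\<lambda>j. feat E j 0 u $v 0)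
      in \<Sum>j<num E. (exp (s j) / (\<Sum>j'<num E. exp (s j'))) *\<^sub>R pt E j)"

definition Phi_S ::
    "(nat \<Rightarrow> real^3 \<Rightarrow> real vec) \<Rightarrow> (nat \<Rightarrow> nat \<Rightarrow> nat \<Rightarrow> real mat) \<Rightarrow> bitr \<Rightarrow> cloud \<Rightarrow> cloud \<Rightarrow> field6" where
  "Phi_S Y CG B P P' =
     transformer dim6 (kernel6 Y CG) (layers6 B)
       \<lparr>num = nkeys B,
        pt = \<lambda>u. (key_point (encode Y CG B P P') u, key_point (encode Y CG B P' P) u),
        chan = key_chan B,
        feat = key_feat B P P'\<rparr>"

definition diag3 :: "real \<Rightarrow> real \<Rightarrow> real \<Rightarrow> real^3^3" where
  "diag3 a b c = vector [vector [a, 0, 0], vector [0, b, 0], vector [0, 0, c]]"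

definition is_svd ::
    "real^3^3 \<Rightarrow> real^3^3 \<Rightarrow> real \<Rightarrow> real \<Rightarrow> real \<Rightarrow> real^3^3 \<Rightarrow> bool" where
  "is_svd A U s1 s2 s3 V \<longleftrightarrow> orthogonal_matrix U \<and> orthogonal_matrix V \<and>
     s1 \<ge> s2 \<and> s2 \<ge> s3 \<and> s3 \<ge> 0 \<and> A = U ** diag3 s1 s2 s3 ** transpose V"

definition singular_values :: "real^3^3 \<Rightarrow> real \<Rightarrow> real \<Rightarrow> real \<Rightarrow> bool" where
  "singular_values A s1 s2 s3 \<longleftrightarrow> (\<exists>U V. is_svd A U s1 s2 s3 V)"

text \<open>If \<open>\<sigma>\<^sub>2 = \<sigma>\<^sub>3\<close>, the result depends on the decomposition, and an arbitrary one is used.\<close>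
definition svd_proj :: "real^3^3 \<Rightarrow> real^3^3" where
  "svd_proj A = (SOME R. \<exists>U s1 s2 s3 V. is_svd A U s1 s2 s3 V \<and>
     R = U ** diag3 1 1 (sgn (det (U ** transpose V))) ** transpose V)"

definition r_hat :: "field6 \<Rightarrow> real^3^3" where
  "r_hat f = to_R33 (unvec 3 3 (pool 9 (num f) (\<lambda>u. feat f u (1, 1) 0)))"

definition Phi_P :: "field6 \<Rightarrow> motion" where
  "Phi_P f =
     (let r = svd_proj (r_hat f);
          tX = to_R3 (pool 3 (num f) (\<lambda>u. feat f u (1, 0) 0));
          tY = to_R3 (pool 3 (num f) (\<lambda>u. feat f u (0, 1) 0));
          mX = mean (num f) (\<lambda>u. fst (pt f u));
          mY = mean (num f) (\<lambda>u. snd (pt f u))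
      in (r, (mY + tY) - r *v (mX + tX)))"

definition Phi_B ::
    "(nat \<Rightarrow> real^3 \<Rightarrow> real vec) \<Rightarrow> (nat \<Rightarrow> nat \<Rightarrow> nat \<Rightarrow> real mat) \<Rightarrow> bitr \<Rightarrow> cloud \<Rightarrow> cloud \<Rightarrow> motion" where
  "Phi_B Y CG B P P' = Phi_P (Phi_S Y CG B P P')"

text \<open>
  Shape constraints of the architecture, and equivariant transport of the input features of the
  6-D field. Weights and radial functions are unconstrained.
\<close>
definition is_bitr :: "(nat \<Rightarrow> real^3^3 \<Rightarrow> real mat) \<Rightarrow> bitr \<Rightarrow> bool" where
  "is_bitr rho B \<longleftrightarrow>
     finite (degs (in_chan B)) \<and>
     (\<forall>n \<in> {1..length (enc_layers B)}.
        degs (fold out_chan (take n (enc_layers B)) (in_chan B)) \<subseteq> {0, 1}) \<and>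
     (let c = fold out_chan (enc_layers B) (in_chan B)
      in out_chan (enc_last B) (fuse_chan c c) = (\<lambda>p. if p = 0 then nkeys B else 0)) \<and>
     finite (degs (key_chan B)) \<and>
     (\<forall>X Y. valid_input B X \<longrightarrow> valid_input B Y \<longrightarrow>
        (\<forall>u < nkeys B. \<forall>d. \<forall>b < key_chan B d.
           key_feat B X Y u d b \<in> carrier_vec (dim6 d) \<and>
           (\<forall>g1\<in>SE3. \<forall>g2\<in>SE3.
              key_feat B (act_cloud rho g1 X) (act_cloud rho g2 Y) u d b =
                rho2 rho d (fst g1) (fst g2) *\<^sub>v key_feat B X Y u d b))) \<and>
     (\<forall>l \<in> set (layers6 B). finite_layer l) \<and>
     fold out_chan (layers6 B) (key_chan B) =
       (\<lambda>d. if d \<in> {(1, 1), (1, 0), (0, 1)} then 1 else 0)"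

end

theory Submission
  imports Defs
begin

text \<open>
  Each layer commutes with the group: distances, hence neighbourhoods, and (by orthogonality of the
  representations) attention logits are invariant, and the Clebsch--Gordan kernels intertwine the
  representations. In 6-D this reduces to 3-D, because unvectorising the second-order
  Clebsch--Gordan matrix applied to \<open>Y\<^sub>J\<^sub>1 \<otimes> Y\<^sub>J\<^sub>2\<close> gives the Kronecker product of two 3-D kernels. So the
  key points follow \<open>g\<^sub>1\<close> and \<open>g\<^sub>2\<close>, and the matrix \<open>A\<close> to be projected becomes \<open>r\<^sub>2 A r\<^sub>1\<^sup>T\<close>. The SVD projection of \<open>A\<close> is the
  unique maximiser of \<open>tr(W\<^sup>T A)\<close> over rotations \<open>W\<close> when \<open>\<sigma>\<^sub>2 > \<sigma>\<^sub>3\<close>, hence well defined, and it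
  inherits this transformation law.
\<close>


section \<open>Kronecker products and vectorisation\<close>

text \<open>Quotient and remainder by \<open>n\<close> enumerate the pairs \<open>(i, j)\<close> in
  blocks of length \<open>n\<close>. All Kronecker indices are numbered this way, so sums over them
  become double sums.\<close>

lemma sum_div_mod:
  fixes f :: "nat \<Rightarrow> nat \<Rightarrow> 'a::comm_monoid_add"
  shows "(\<Sum>k<m * n. f (k div n) (k mod n)) = (\<Sum>i<m. \<Sum>j<n. f i j)"
proof -
  have "(\<Sum>k<m * n. f (k div n) (k mod n)) = (\<Sum>i<m. \<Sum>k\<in>{i * n..<i * n + n}. f (k div n) (k mod n))"
    by (rule sum.nat_group[symmetric])
  also have "\<dots> = (\<Sum>i<m. \<Sum>j<n. f i j)"
  proof (rule sum.cong[OF refl])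
    fix i
    have "(\<Sum>k\<in>{i * n..<i * n + n}. f (k div n) (k mod n))
        = (\<Sum>j\<in>{0..<n}. f ((j + i * n) div n) ((j + i * n) mod n))"
      using sum.shift_bounds_nat_ivl[of "\<lambda>k. f (k div n) (k mod n)" 0 "i * n" n] by (simp add: add.commute)
    also have "\<dots> = (\<Sum>j<n. f i j)"
      by (rule sum.cong) auto
    finally show "(\<Sum>k\<in>{i * n..<i * n + n}. f (k div n) (k mod n)) = (\<Sum>j<n. f i j)" .
  qed
  finally show ?thesis .
qed

lemma div_less_of_less_mult: "k < m * n \<Longrightarrow> k div n < (m::nat)"
  by (simp add: less_mult_imp_div_less)

lemma mod_less_of_less_mult: "k < m * n \<Longrightarrow> k mod n < (n::nat)"
  by (cases "n = 0") auto

lemma mult_mat_entry: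
  assumes "A \<in> carrier_mat nr n" "B \<in> carrier_mat n nc" "i < nr" "j < nc"
  shows "(A * B) $$ (i, j) = (\<Sum>k<n. A $$ (i, k) * B $$ (k, j))"
  using assms by (auto simp: scalar_prod_def lessThan_atLeast0 intro!: sum.cong)

lemma mult_mat_vec_entry:
  assumes "A \<in> carrier_mat nr n" "w \<in> carrier_vec n" "i < nr"
  shows "(A *\<^sub>v w) $v i = (\<Sum>k<n. A $$ (i, k) * w $v k)"
  using assms by (auto simp: scalar_prod_def lessThan_atLeast0 intro!: sum.cong)

lemma kron_carrier [simp, intro]:
  "A \<in> carrier_mat a b \<Longrightarrow> B \<in> carrier_mat c d \<Longrightarrow> kron A B \<in> carrier_mat (a * c) (b * d)"
  by (auto simp: kron_def)

lemma kron_entry: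
  assumes "A \<in> carrier_mat a b" "B \<in> carrier_mat c d" "i < a * c" "j < b * d"
  shows "kron A B $$ (i, j) = A $$ (i div c, j div d) * B $$ (i mod c, j mod d)"
  using assms by (auto simp: kron_def)

text \<open>The mixed product rule: after splitting the summation index into quotient and remainder,
  the summand is a product of a term in each, and the double sum factors.\<close>

lemma kron_mult:
  assumes A: "A \<in> carrier_mat a b" and B: "B \<in> carrier_mat a' b'"
    and C: "C \<in> carrier_mat b c" and D: "D \<in> carrier_mat b' c'"
  shows "kron A B * kron C D = kron (A * C) (B * D)"
proof (rule eq_matI)
  fix i j assume ij: "i < dim_row (kron (A * C) (B * D))" "j < dim_col (kron (A * C) (B * D))"
  have AC: "A * C \<in> carrier_mat a c" and BD: "B * D \<in> carrier_mat a' c'"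
    using assms by auto
  have i: "i < a * a'" and j: "j < c * c'"
    using ij kron_carrier[OF AC BD] by auto
  note lt = div_less_of_less_mult[OF i] div_less_of_less_mult[OF j]
    mod_less_of_less_mult[OF i] mod_less_of_less_mult[OF j]
  have "(kron A B * kron C D) $$ (i, j) = (\<Sum>k<b * b'.
      (A $$ (i div a', k div b') * C $$ (k div b', j div c')) *
      (B $$ (i mod a', k mod b') * D $$ (k mod b', j mod c')))"
    by (subst mult_mat_entry[OF kron_carrier[OF A B] kron_carrier[OF C D] i j])
      (auto simp: kron_entry[OF A B i] kron_entry[OF C D _ j] intro!: sum.cong)
  also have "\<dots> = (\<Sum>k<b. A $$ (i div a', k) * C $$ (k, j div c')) *
      (\<Sum>k<b'. B $$ (i mod a', k) * D $$ (k, j mod c'))"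
    by (subst sum_div_mod) (simp add: sum_product)
  also have "\<dots> = kron (A * C) (B * D) $$ (i, j)"
    by (simp add: kron_entry[OF AC BD i j] mult_mat_entry[OF A C] mult_mat_entry[OF B D] lt)
  finally show "(kron A B * kron C D) $$ (i, j) = kron (A * C) (B * D) $$ (i, j)" .
qed (use assms in \<open>auto simp: kron_def\<close>)

lemma transpose_kron: "transpose_mat (kron A B) = kron (transpose_mat A) (transpose_mat B)"
  by (rule eq_matI)
    (auto simp: kron_def div_less_of_less_mult mod_less_of_less_mult mult.commute)

lemma kron_one: "kron (1\<^sub>m m) (1\<^sub>m n) = 1\<^sub>m (m * n)"
proof (rule eq_matI)
  fix i j assume "i < dim_row (1\<^sub>m (m * n) :: real mat)" "j < dim_col (1\<^sub>m (m * n) :: real mat)"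
  then have i: "i < m * n" and j: "j < m * n" by auto
  have "i = j \<longleftrightarrow> i div n = j div n \<and> i mod n = j mod n"
    by (metis div_mult_mod_eq)
  then show "kron (1\<^sub>m m) (1\<^sub>m n) $$ (i, j) = 1\<^sub>m (m * n) $$ (i, j)"
    using i j div_less_of_less_mult[OF i] div_less_of_less_mult[OF j]
    mod_less_of_less_mult[OF i] mod_less_of_less_mult[OF j]
    by (auto simp: kron_def)
qed (auto simp: kron_def)

lemma unvec_carrier [simp]: "unvec nr nc v \<in> carrier_mat nr nc"
  by (simp add: unvec_def)

lemma unvec_index_less: "i < nr \<Longrightarrow> j < nc \<Longrightarrow> j * nr + i < nc * (nr::nat)"
proof -
  assume "i < nr" "j < nc"
  then have "j * nr + i < Suc j * nr" by simp
  also have "\<dots> \<le> nc * nr" using \<open>j < nc\<close> by (intro mult_le_mono1) simp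
  finally show ?thesis .
qed

text \<open>This is \<open>vec(B X A^T) = (A \<otimes> B) vec(X)\<close>. Column stacking puts entry
  \<open>(i, j)\<close> at \<open>j * nr + i\<close>, so the quotient by \<open>nr\<close> meets
  \<open>A\<close> and the remainder meets \<open>B\<close>.\<close>

lemma unvec_kron:
  assumes A: "A \<in> carrier_mat nc nc" and B: "B \<in> carrier_mat nr nr"
    and v: "v \<in> carrier_vec (nc * nr)"
  shows "unvec nr nc (kron A B *\<^sub>v v) = B * unvec nr nc v * transpose_mat A"
proof (rule eq_matI)
  fix i j assume "i < dim_row (B * unvec nr nc v * transpose_mat A)"
    "j < dim_col (B * unvec nr nc v * transpose_mat A)"
  then have i: "i < nr" and j: "j < nc" using A B by auto
  note ij = unvec_index_less[OF i j]
  have "unvec nr nc (kron A B *\<^sub>v v) $$ (i, j) = (kron A B *\<^sub>v v) $v (j * nr + i)"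
    using i j by (simp add: unvec_def)
  also have "\<dots> = (\<Sum>k<nc * nr. A $$ (j, k div nr) * B $$ (i, k mod nr) * v $v ((k div nr) * nr + k mod nr))"
    using i by (subst mult_mat_vec_entry[OF kron_carrier[OF A B] v ij])
      (auto simp: kron_entry[OF A B ij] intro!: sum.cong)
  also have "\<dots> = (\<Sum>k<nc. \<Sum>l<nr. A $$ (j, k) * B $$ (i, l) * v $v (k * nr + l))"
    by (subst sum_div_mod) simp
  also have "\<dots> = (\<Sum>k<nc. (\<Sum>l<nr. B $$ (i, l) * unvec nr nc v $$ (l, k)) * A $$ (j, k))"
    by (auto simp: sum_distrib_right unvec_def intro!: sum.cong)
  also have "\<dots> = (B * unvec nr nc v * transpose_mat A) $$ (i, j)"
    using A i j
    by (subst mult_mat_entry[OF mult_carrier_mat[OF B unvec_carrier]])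
      (auto simp: mult_mat_entry[OF B unvec_carrier] intro!: sum.cong)
  finally show "unvec nr nc (kron A B *\<^sub>v v) $$ (i, j) = (B * unvec nr nc v * transpose_mat A) $$ (i, j)" .
qed (use A B in \<open>auto simp: unvec_def\<close>)


section \<open>Finite sums of vectors\<close>

lemma vsum_carrier [simp]: "vsum n f A \<in> carrier_vec n"
  by (simp add: vsum_def)

lemma vsum_cong: "A = B \<Longrightarrow> (\<And>x. x \<in> B \<Longrightarrow> f x = g x) \<Longrightarrow> vsum n f A = vsum n g B"
  by (simp add: vsum_def cong: sum.cong)

lemma mult_mat_vsum:
  assumes M: "M \<in> carrier_mat m n" and f: "\<And>x. x \<in> A \<Longrightarrow> f x \<in> carrier_vec n"
  shows "M *\<^sub>v vsum n f A = vsum m (\<lambda>x. M *\<^sub>v f x) A"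
proof (rule eq_vecI)
  fix i assume "i < dim_vec (vsum m (\<lambda>x. M *\<^sub>v f x) A)"
  then have i: "i < m" by (simp add: vsum_def)
  have "(M *\<^sub>v vsum n f A) $v i = (\<Sum>k<n. \<Sum>x\<in>A. M $$ (i, k) * f x $v k)"
    by (subst mult_mat_vec_entry[OF M _ i]) (auto simp: vsum_def sum_distrib_left)
  also have "\<dots> = (\<Sum>x\<in>A. \<Sum>k<n. M $$ (i, k) * f x $v k)"
    by (rule sum.swap)
  also have "\<dots> = vsum m (\<lambda>x. M *\<^sub>v f x) A $v i"
    using i by (simp add: vsum_def mult_mat_vec_entry[OF M f i] cong: sum.cong)
  finally show "(M *\<^sub>v vsum n f A) $v i = vsum m (\<lambda>x. M *\<^sub>v f x) A $v i" .
qed (use M in \<open>auto simp: vsum_def\<close>)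

text \<open>Kernels are defined by unvectorising a sum over the degrees \<open>J\<close>; this lets
  them act on a feature term by term, so that equivariance can be checked for each \<open>J\<close>
  separately.\<close>

lemma unvec_vsum_mult_vec:
  assumes w: "w \<in> carrier_vec nc" and f: "\<And>x. x \<in> A \<Longrightarrow> f x \<in> carrier_vec (nc * nr)"
  shows "unvec nr nc (vsum (nc * nr) (\<lambda>x. c x \<cdot>\<^sub>v f x) A) *\<^sub>v w
    = vsum nr (\<lambda>x. c x \<cdot>\<^sub>v (unvec nr nc (f x) *\<^sub>v w)) A" (is "?L = ?R")
proof (rule eq_vecI)
  fix i assume "i < dim_vec ?R"
  then have i: "i < nr" by (simp add: vsum_def)
  have "?L $v i = (\<Sum>k<nc. (\<Sum>x\<in>A. c x * f x $v (k * nr + i)) * w $v k)"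
    by (subst mult_mat_vec_entry[OF unvec_carrier w i])
      (use i carrier_vecD[OF f] in \<open>auto simp: unvec_def vsum_def unvec_index_less intro!: sum.cong\<close>)
  also have "\<dots> = (\<Sum>x\<in>A. c x * (\<Sum>k<nc. f x $v (k * nr + i) * w $v k))"
    unfolding sum_distrib_right sum_distrib_left by (subst sum.swap) (simp add: mult.assoc)
  also have "\<dots> = ?R $v i"
  proof -
    have "(unvec nr nc (f x) *\<^sub>v w) $v i = (\<Sum>k<nc. f x $v (k * nr + i) * w $v k)" for x
      using i by (subst mult_mat_vec_entry[OF unvec_carrier w i]) (simp add: unvec_def)
    moreover have "dim_vec (unvec nr nc (f x) *\<^sub>v w) = nr" for x
      by (simp add: unvec_def)
    ultimately show ?thesis
      using i by (simp add: vsum_def)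
  qed
  finally show "?L $v i = ?R $v i" .
qed (auto simp: vsum_def unvec_def)

lemma pool_carrier [simp]: "pool n N f \<in> carrier_vec n"
  by (simp add: pool_def)

lemma mult_mat_pool:
  assumes M: "M \<in> carrier_mat m n" and f: "\<And>u. u < N \<Longrightarrow> f u \<in> carrier_vec n"
  shows "M *\<^sub>v pool n N f = pool m N (\<lambda>u. M *\<^sub>v f u)"
  using assms mult_mat_vec[OF M, of "vsum n f {..<N}"] mult_mat_vsum[OF M, of "{..<N}" f]
  by (simp add: pool_def)

lemma pool_cong: "N = N' \<Longrightarrow> (\<And>u. u < N' \<Longrightarrow> f u = g u) \<Longrightarrow> pool n N f = pool n N' g"
  unfolding pool_def by (metis vsum_cong lessThan_iff)


section \<open>Steerable kernels\<close>

lemma vkron_carrier: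
  "v \<in> carrier_vec m \<Longrightarrow> w \<in> carrier_vec n \<Longrightarrow> vkron v w \<in> carrier_vec (m * n)"
  by (intro carrier_vecI) (simp add: vkron_def)

lemma cg2_carrier: "cg2 CG d i J1 J2 \<in> carrier_mat (dim6 i * dim6 d) (dim6 (J1, J2))"
  by (cases d; cases i; hypsubst; subst cg2.simps) (rule mat_carrier)

text \<open>Unvectorising splits the row \<open>(m1, m2, m3, m4)\<close> of \<open>cg2\<close> into
  column \<open>(m1, m2)\<close> and row \<open>(m3, m4)\<close>. Each entry is a product of a
  factor in \<open>m1, m3, m5\<close> and one in \<open>m2, m4, m6\<close>, and the vector
  \<open>vkron y1 y2\<close> splits in the same way, so the sum over \<open>(m5, m6)\<close>
  factors.\<close>

lemma cg2_mult_vkron: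
  assumes C1: "CG i1 o1 J1 \<in> carrier_mat ((2 * i1 + 1) * (2 * o1 + 1)) (2 * J1 + 1)"
    and C2: "CG i2 o2 J2 \<in> carrier_mat ((2 * i2 + 1) * (2 * o2 + 1)) (2 * J2 + 1)"
    and y1: "y1 \<in> carrier_vec (2 * J1 + 1)" and y2: "y2 \<in> carrier_vec (2 * J2 + 1)"
  shows "unvec (dim6 (o1, o2)) (dim6 (i1, i2)) (cg2 CG (o1, o2) (i1, i2) J1 J2 *\<^sub>v vkron y1 y2)
    = kron (unvec (2 * o1 + 1) (2 * i1 + 1) (CG i1 o1 J1 *\<^sub>v y1))
           (unvec (2 * o2 + 1) (2 * i2 + 1) (CG i2 o2 J2 *\<^sub>v y2))" (is "?L = kron ?K1 ?K2")
proof (rule eq_matI)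
  fix b a assume "b < dim_row (kron ?K1 ?K2)" "a < dim_col (kron ?K1 ?K2)"
  then have b: "b < (2 * o1 + 1) * (2 * o2 + 1)" and a: "a < (2 * i1 + 1) * (2 * i2 + 1)"
    by (simp_all only: kron_def unvec_def dim_row_mat dim_col_mat)
  note ineqs = div_less_of_less_mult[OF b] mod_less_of_less_mult[OF b]
    div_less_of_less_mult[OF a] mod_less_of_less_mult[OF a]
  \<comment> \<open>With \<open>a = (m1, m2)\<close> and \<open>b = (m3, m4)\<close>, these are the
    row numbers of \<open>(m1, m3)\<close> and \<open>(m2, m4)\<close> in the two first-order
    Clebsch-Gordan matrices, and also the positions read by \<open>unvec\<close> in the two
    factors.\<close>
  define r1 where "r1 = a div (2 * i2 + 1) * (2 * o1 + 1) + b div (2 * o2 + 1)"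
  define r2 where "r2 = a mod (2 * i2 + 1) * (2 * o2 + 1) + b mod (2 * o2 + 1)"
  have r1: "r1 < (2 * i1 + 1) * (2 * o1 + 1)" and r2: "r2 < (2 * i2 + 1) * (2 * o2 + 1)"
    unfolding r1_def r2_def using ineqs by (intro unvec_index_less; simp)+
  let ?Q = "cg2 CG (o1, o2) (i1, i2) J1 J2"
  have Q: "?Q \<in> carrier_mat (dim6 (i1, i2) * dim6 (o1, o2)) ((2 * J1 + 1) * (2 * J2 + 1))"
    using cg2_carrier[of CG "(o1, o2)" "(i1, i2)" J1 J2] by (simp only: dim6.simps)
  have y: "vkron y1 y2 \<in> carrier_vec ((2 * J1 + 1) * (2 * J2 + 1))"
    using y1 y2 by (rule vkron_carrier)
  have row: "a * dim6 (o1, o2) + b < dim6 (i1, i2) * dim6 (o1, o2)"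
    using a b by (intro unvec_index_less) (simp_all only: dim6.simps)
  have entry: "?Q $$ (a * dim6 (o1, o2) + b, k)
      = CG i1 o1 J1 $$ (r1, k div (2 * J2 + 1)) * CG i2 o2 J2 $$ (r2, k mod (2 * J2 + 1))"
    if k: "k < (2 * J1 + 1) * (2 * J2 + 1)" for k
  proof -
    have "(a * n + b) div n = a" "(a * n + b) mod n = b" if "b < n" for n
      using that by auto
    with b have "(a * dim6 (o1, o2) + b) div dim6 (o1, o2) = a"
      "(a * dim6 (o1, o2) + b) mod dim6 (o1, o2) = b"
      by (simp_all only: dim6.simps)
    then show ?thesis
      using k row
      by (simp only: cg2.simps dim6.simps index_mat(1) case_prod_conv cg_entry_def r1_def r2_def Let_def)
  qed
  have "?L $$ (b, a) = (?Q *\<^sub>v vkron y1 y2) $v (a * dim6 (o1, o2) + b)"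
    using a b by (simp add: unvec_def)
  also have "\<dots> = (\<Sum>k<(2 * J1 + 1) * (2 * J2 + 1).
      ?Q $$ (a * dim6 (o1, o2) + b, k) * vkron y1 y2 $v k)"
    by (rule mult_mat_vec_entry[OF Q y row])
  also have "\<dots> = (\<Sum>k<(2 * J1 + 1) * (2 * J2 + 1).
      (CG i1 o1 J1 $$ (r1, k div (2 * J2 + 1)) * y1 $v (k div (2 * J2 + 1))) *
      (CG i2 o2 J2 $$ (r2, k mod (2 * J2 + 1)) * y2 $v (k mod (2 * J2 + 1))))"
  proof (intro sum.cong refl)
    fix k assume "k \<in> {..<(2 * J1 + 1) * (2 * J2 + 1)}"
    then have k: "k < (2 * J1 + 1) * (2 * J2 + 1)" by simp
    then have "vkron y1 y2 $v k = y1 $v (k div (2 * J2 + 1)) * y2 $v (k mod (2 * J2 + 1))"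
      using y1 y2 by (simp only: vkron_def index_vec carrier_vecD)
    then show "?Q $$ (a * dim6 (o1, o2) + b, k) * vkron y1 y2 $v k
        = (CG i1 o1 J1 $$ (r1, k div (2 * J2 + 1)) * y1 $v (k div (2 * J2 + 1))) *
          (CG i2 o2 J2 $$ (r2, k mod (2 * J2 + 1)) * y2 $v (k mod (2 * J2 + 1)))"
      by (simp only: entry[OF k] mult_ac)
  qed
  also have "\<dots> = (\<Sum>k<2 * J1 + 1. CG i1 o1 J1 $$ (r1, k) * y1 $v k) *
      (\<Sum>k<2 * J2 + 1. CG i2 o2 J2 $$ (r2, k) * y2 $v k)"
    by (subst sum_div_mod) (simp only: sum_product)
  also have "\<dots> = (CG i1 o1 J1 *\<^sub>v y1) $v r1 * (CG i2 o2 J2 *\<^sub>v y2) $v r2"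
    by (simp only: mult_mat_vec_entry[OF C1 y1 r1] mult_mat_vec_entry[OF C2 y2 r2])
  also have "\<dots> = kron ?K1 ?K2 $$ (b, a)"
    unfolding kron_entry[OF unvec_carrier unvec_carrier b a]
    using ineqs by (simp add: unvec_def r1_def r2_def)
  finally show "?L $$ (b, a) = kron ?K1 ?K2 $$ (b, a)" .
qed (auto simp: kron_def unvec_def)

section \<open>Rotations and their orthogonal representations\<close>

lemma rotation_inverse:
  assumes "r \<in> SO3"
  shows "transpose r \<in> SO3" "transpose r ** r = Finite_Cartesian_Product.mat 1"
    "r ** transpose r = Finite_Cartesian_Product.mat 1"
  using assms by (auto simp: SO3_def rotation_matrix_def orthogonal_matrix_def)

lemma id_in_SO3: "Finite_Cartesian_Product.mat 1 \<in> SO3"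
  by (simp add: SO3_def rotation_matrix_def orthogonal_matrix_id)

lemma norm_rotation: "r \<in> SO3 \<Longrightarrow> norm (r *v x) = norm (x :: real^3)"
  by (metis SO3_def mem_Collect_eq rotation_matrix_def matrix_of_matrix_vector_mul
      matrix_vector_mul_linear orthogonal_transformation_matrix orthogonal_transformation_norm)

text \<open>The definition supplies the transpose as a right inverse only. The image of the identity
  is idempotent and has a right inverse, hence is \<open>1\<close>; so
  \<open>R (transpose r)\<close> is a left inverse of \<open>R r\<close> and must coincide with the
  right inverse.\<close>

lemma orthogonal_rep_transpose_mult:
  assumes R: "SO3_orthogonal_rep n R" and r: "r \<in> SO3"
  shows "transpose_mat (R r) * R r = 1\<^sub>m n"
proof -
  let ?e = "Finite_Cartesian_Product.mat 1 :: real^3^3"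
  have c: "R s \<in> carrier_mat n n" "R s * transpose_mat (R s) = 1\<^sub>m n" if "s \<in> SO3" for s
    using R that by (auto simp: SO3_orthogonal_rep_def)
  have hom: "R (s ** t) = R s * R t" if "s \<in> SO3" "t \<in> SO3" for s t
    using R that by (auto simp: SO3_orthogonal_rep_def)
  note e = c[OF id_in_SO3] and r' = c[OF r] and t = rotation_inverse[OF r]
  have "R ?e = R ?e * (R ?e * transpose_mat (R ?e))"
    using e by simp
  also have "\<dots> = (R ?e * R ?e) * transpose_mat (R ?e)"
    using e by (intro assoc_mult_mat[symmetric]) auto
  also have "\<dots> = 1\<^sub>m n"
    using e hom[OF id_in_SO3 id_in_SO3] by simp
  finally have inv: "R (transpose r) * R r = 1\<^sub>m n"
    using hom[OF t(1) r] t by simp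
  have "R (transpose r) = R (transpose r) * (R r * transpose_mat (R r))"
    using r' c[OF t(1)] by simp
  also have "\<dots> = (R (transpose r) * R r) * transpose_mat (R r)"
    using r' c[OF t(1)] by (intro assoc_mult_mat[symmetric]) auto
  also have "\<dots> = transpose_mat (R r)"
    using r' inv by simp
  finally show ?thesis
    using inv by simp
qed

section \<open>Equivariance of the 3-D kernels\<close>

locale steerable_basis =
  fixes rho :: "nat \<Rightarrow> real^3^3 \<Rightarrow> real mat"
    and sh :: "nat \<Rightarrow> real^3 \<Rightarrow> real vec"
    and CG :: "nat \<Rightarrow> nat \<Rightarrow> nat \<Rightarrow> real mat"
  assumes irreps: "SO3_irreps rho"
    and harmonics: "spherical_harmonics rho sh"
    and clebsch: "clebsch_gordan rho CG"
begin

lemma rho_carrier: "r \<in> SO3 \<Longrightarrow> rho p r \<in> carrier_mat (2 * p + 1) (2 * p + 1)"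
  using irreps by (auto simp: SO3_irreps_def SO3_orthogonal_rep_def)

lemma rho_transpose_mult: "r \<in> SO3 \<Longrightarrow> transpose_mat (rho p r) * rho p r = 1\<^sub>m (2 * p + 1)"
  using irreps by (auto simp: SO3_irreps_def intro: orthogonal_rep_transpose_mult)

lemma rho_0: "r \<in> SO3 \<Longrightarrow> rho 0 r = 1\<^sub>m 1"
  using irreps by (auto simp: SO3_irreps_def)

lemma rho_1: "r \<in> SO3 \<Longrightarrow> to_R33 (rho 1 r) = r"
  using irreps by (auto simp: SO3_irreps_def)

lemma CG_carrier:
  "J \<in> tri i l \<Longrightarrow> CG i l J \<in> carrier_mat ((2 * i + 1) * (2 * l + 1)) (2 * J + 1)"
  using clebsch by (auto simp: clebsch_gordan_def)

lemma CG_intertwines: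
  "J \<in> tri i l \<Longrightarrow> r \<in> SO3 \<Longrightarrow> kron (rho i r) (rho l r) * CG i l J = CG i l J * rho J r"
  using clebsch by (auto simp: clebsch_gordan_def)

lemma Y_dir_carrier: "Y_dir sh J x \<in> carrier_vec (2 * J + 1)"
proof -
  have sh: "sh J x \<in> carrier_vec (2 * J + 1)" if "norm x = 1" for J x
    using harmonics that by (auto simp: spherical_harmonics_def)
  show ?thesis
    using sh[of "x /\<^sub>R norm x" J] sh[of "axis 1 1" 0] by (auto simp: Y_dir_def)
qed

lemma vkron_dim6: "vkron (Y_dir sh J1 x1) (Y_dir sh J2 x2) \<in> carrier_vec (dim6 (J1, J2))"
  by (simp only: dim6.simps vkron_carrier Y_dir_carrier)

lemma Y_dir_rotate:
  assumes r: "r \<in> SO3"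
  shows "Y_dir sh J (r *v x) = rho J r *\<^sub>v Y_dir sh J x"
proof (cases "x = 0")
  case True
  \<comment> \<open>The convention at the origin is compatible with rotations: the zero vector is
    fixed by every matrix, and for \<open>J = 0\<close> the constant is fixed because
    \<open>rho 0 r\<close> is the identity.\<close>
  have "0\<^sub>v (2 * J + 1) = rho J r *\<^sub>v 0\<^sub>v (2 * J + 1)"
    using rho_carrier[OF r, of J] by (intro eq_vecI) auto
  moreover have "sh 0 (axis 1 1) \<in> carrier_vec 1"
    using harmonics by (auto simp: spherical_harmonics_def dest: spec[of _ 0])
  ultimately show ?thesis
    using True rho_0[OF r] by (auto simp: Y_dir_def)
next
  case False
  then have "r *v x \<noteq> 0"
    using norm_rotation[OF r, of x] by auto
  then have "Y_dir sh J (r *v x) = sh J (r *v (x /\<^sub>R norm x))"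
    by (simp add: Y_dir_def norm_rotation[OF r] matrix_vector_mult_scaleR)
  also have "\<dots> = rho J r *\<^sub>v sh J (x /\<^sub>R norm x)"
    using harmonics r False by (auto simp: spherical_harmonics_def)
  finally show ?thesis
    using False by (simp add: Y_dir_def)
qed

text \<open>The angular part of one summand of a kernel. The radial factor is split off because it
  depends on the norm alone and is therefore rotation invariant.\<close>

definition basis_kernel :: "nat \<Rightarrow> nat \<Rightarrow> nat \<Rightarrow> real^3 \<Rightarrow> real mat" where
  "basis_kernel l k J x = unvec (2 * l + 1) (2 * k + 1) (CG k l J *\<^sub>v Y_dir sh J x)"

lemma basis_kernel_carrier [simp]: "basis_kernel l k J x \<in> carrier_mat (2 * l + 1) (2 * k + 1)"
  by (simp add: basis_kernel_def)

lemma CG_Y_carrier: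
  "J \<in> tri k l \<Longrightarrow> CG k l J *\<^sub>v Y_dir sh J x \<in> carrier_vec ((2 * k + 1) * (2 * l + 1))"
  by (rule mult_mat_vec_carrier[OF CG_carrier Y_dir_carrier])

text \<open>Rotating \<open>x\<close> multiplies the harmonics by \<open>rho J r\<close>; the
  Clebsch-Gordan matrix turns this into \<open>kron (rho k r) (rho l r)\<close>, which after
  unvectorising is multiplication by \<open>rho l r\<close> on the left and by the transpose of
  \<open>rho k r\<close> on the right. Orthogonality cancels that transpose.\<close>

lemma basis_kernel_rotate:
  assumes r: "r \<in> SO3" and J: "J \<in> tri k l"
  shows "basis_kernel l k J (r *v x) * rho k r = rho l r * basis_kernel l k J x"
proof -
  note carriers = rho_carrier[OF r, of k] rho_carrier[OF r, of l] rho_carrier[OF r, of J]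
    CG_carrier[OF J] Y_dir_carrier[of J x]
  have "CG k l J *\<^sub>v (rho J r *\<^sub>v Y_dir sh J x) = (CG k l J * rho J r) *\<^sub>v Y_dir sh J x"
    using carriers by (intro assoc_mult_mat_vec[symmetric])
  also have "\<dots> = kron (rho k r) (rho l r) *\<^sub>v (CG k l J *\<^sub>v Y_dir sh J x)"
    unfolding CG_intertwines[OF J r, symmetric]
    by (rule assoc_mult_mat_vec[OF kron_carrier[OF carriers(1,2)] carriers(4,5)])
  finally have "basis_kernel l k J (r *v x) = rho l r * basis_kernel l k J x * transpose_mat (rho k r)"
    using carriers CG_Y_carrier[OF J]
    by (simp add: basis_kernel_def Y_dir_rotate[OF r] unvec_kron)
  then have "basis_kernel l k J (r *v x) * rho k r
      = (rho l r * basis_kernel l k J x) * (transpose_mat (rho k r) * rho k r)"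
    by (simp only: assoc_mult_mat[OF mult_carrier_mat[OF carriers(2) basis_kernel_carrier]
          transpose_carrier_mat[THEN iffD2, OF carriers(1)] carriers(1)])
  then show ?thesis
    by (simp only: rho_transpose_mult[OF r]
        right_mult_one_mat[OF mult_carrier_mat[OF carriers(2) basis_kernel_carrier]])
qed

lemma kernel3_mult_vec:
  assumes "w \<in> carrier_vec (dim3 k)"
  shows "kernel3 sh CG phi l k x *\<^sub>v w
    = vsum (dim3 l) (\<lambda>J. phi J (norm x) \<cdot>\<^sub>v (basis_kernel l k J x *\<^sub>v w)) (tri k l)"
  unfolding kernel3_def basis_kernel_def dim3.simps
  using assms CG_Y_carrier by (intro unvec_vsum_mult_vec) auto

text \<open>The radial coefficients are scalars unchanged by the rotation, so the intertwining
  property passes from the basis kernels to their combination.\<close>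

lemma kernel3_rotate:
  assumes r: "r \<in> SO3" and w: "w \<in> carrier_vec (dim3 k)"
  shows "kernel3 sh CG phi l k (r *v x) *\<^sub>v (rho k r *\<^sub>v w)
    = rho l r *\<^sub>v (kernel3 sh CG phi l k x *\<^sub>v w)"
proof -
  note carriers = rho_carrier[OF r, of k] rho_carrier[OF r, of l]
  have w': "w \<in> carrier_vec (2 * k + 1)"
    using w by simp
  have rw: "rho k r *\<^sub>v w \<in> carrier_vec (dim3 k)"
    using w carriers by auto
  have "basis_kernel l k J (r *v x) *\<^sub>v (rho k r *\<^sub>v w) = rho l r *\<^sub>v (basis_kernel l k J x *\<^sub>v w)"
    if "J \<in> tri k l" for J
    using basis_kernel_rotate[OF r that] assoc_mult_mat_vec[OF basis_kernel_carrier carriers(1) w']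
      assoc_mult_mat_vec[OF carriers(2) basis_kernel_carrier w'] by metis
  then show ?thesis
    unfolding kernel3_mult_vec[OF w] kernel3_mult_vec[OF rw] norm_rotation[OF r]
    using carriers mult_mat_vec_carrier[OF basis_kernel_carrier w']
    by (subst mult_mat_vsum[of _ _ "dim3 l"])
      (auto simp: mult_mat_vec[of _ "2 * l + 1" "2 * l + 1"] intro!: vsum_cong)
qed

section \<open>Equivariance of the 6-D kernels\<close>

lemma rho2_carrier:
  "r1 \<in> SO3 \<Longrightarrow> r2 \<in> SO3 \<Longrightarrow> rho2 rho d r1 r2 \<in> carrier_mat (dim6 d) (dim6 d)"
  by (cases d) (simp only: rho2.simps dim6.simps kron_carrier rho_carrier)

lemma rho2_transpose_mult:
  assumes "r1 \<in> SO3" "r2 \<in> SO3"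
  shows "transpose_mat (rho2 rho d r1 r2) * rho2 rho d r1 r2 = 1\<^sub>m (dim6 d)"
proof (cases d)
  case (Pair p q)
  then show ?thesis
    using kron_mult[OF transpose_carrier_mat[THEN iffD2, OF rho_carrier[OF assms(1), of p]]
        transpose_carrier_mat[THEN iffD2, OF rho_carrier[OF assms(2), of q]]
        rho_carrier[OF assms(1), of p] rho_carrier[OF assms(2), of q]]
    by (simp add: transpose_kron rho_transpose_mult[OF assms(1)] rho_transpose_mult[OF assms(2)] kron_one
        del: mult_Suc mult_Suc_right)
qed

text \<open>\<open>kernel6\<close> lists the output degree first in \<open>tri\<close>, whereas the
  matrices \<open>CG\<close> inside \<open>cg2\<close> take the input degree first.\<close>

lemma tri_commute: "tri i l = tri l i"
  by (simp add: tri_def abs_minus_commute add.commute)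

lemma kernel6_mult_vec:
  assumes w: "w \<in> carrier_vec (dim6 (i1, i2))"
  shows "kernel6 sh CG phi (o1, o2) (i1, i2) (z1, z2) *\<^sub>v w
    = vsum (dim6 (o1, o2)) (\<lambda>(J1, J2). phi J1 J2 (norm z1) (norm z2) \<cdot>\<^sub>v
        (kron (basis_kernel o1 i1 J1 z1) (basis_kernel o2 i2 J2 z2) *\<^sub>v w)) (tri i1 o1 \<times> tri i2 o2)"
proof -
  let ?d = "dim6 (o1, o2)" and ?i = "dim6 (i1, i2)"
  \<comment> \<open>The index pair is written with projections so that scalar coefficient and vector
    are separate functions of one index, the form that \<open>unvec_vsum_mult_vec\<close>
    handles.\<close>
  have "kernel6 sh CG phi (o1, o2) (i1, i2) (z1, z2) *\<^sub>v w
    = vsum ?d (\<lambda>J. phi (fst J) (snd J) (norm z1) (norm z2) \<cdot>\<^sub>v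
        (unvec ?d ?i (cg2 CG (o1, o2) (i1, i2) (fst J) (snd J) *\<^sub>v
          vkron (Y_dir sh (fst J) z1) (Y_dir sh (snd J) z2)) *\<^sub>v w)) (tri i1 o1 \<times> tri i2 o2)"
    unfolding kernel6_def case_prod_beta fst_conv snd_conv tri_commute[of o1 i1] tri_commute[of o2 i2]
    by (intro unvec_vsum_mult_vec w mult_mat_vec_carrier[OF cg2_carrier] vkron_dim6)
  also have "\<dots> = vsum ?d (\<lambda>(J1, J2). phi J1 J2 (norm z1) (norm z2) \<cdot>\<^sub>v
        (kron (basis_kernel o1 i1 J1 z1) (basis_kernel o2 i2 J2 z2) *\<^sub>v w)) (tri i1 o1 \<times> tri i2 o2)"
    by (intro vsum_cong)
      (auto simp: cg2_mult_vkron[OF CG_carrier CG_carrier Y_dir_carrier Y_dir_carrier] basis_kernel_def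
        simp del: dim6.simps cg2.simps)
  finally show ?thesis .
qed

text \<open>Each summand is a Kronecker product of two basis kernels. By the mixed product rule the
  two factors intertwine independently, one with \<open>r1\<close> and one with
  \<open>r2\<close>.\<close>

lemma kernel6_rotate:
  assumes r1: "r1 \<in> SO3" and r2: "r2 \<in> SO3" and w: "w \<in> carrier_vec (dim6 i)"
  shows "kernel6 sh CG phi d i (r1 *v fst z, r2 *v snd z) *\<^sub>v (rho2 rho i r1 r2 *\<^sub>v w)
    = rho2 rho d r1 r2 *\<^sub>v (kernel6 sh CG phi d i z *\<^sub>v w)"
proof -
  obtain o1 o2 i1 i2 z1 z2 where dec: "d = (o1, o2)" "i = (i1, i2)" "z = (z1, z2)"
    by (metis surj_pair)
  let ?K = "\<lambda>J1 J2 z1 z2. kron (basis_kernel o1 i1 J1 z1) (basis_kernel o2 i2 J2 z2)"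
  have Ri: "rho2 rho i r1 r2 \<in> carrier_mat (dim6 i) (dim6 i)"
    and Rd: "rho2 rho d r1 r2 \<in> carrier_mat (dim6 d) (dim6 d)"
    using r1 r2 by (auto intro: rho2_carrier)
  have K: "?K J1 J2 z1 z2 \<in> carrier_mat (dim6 d) (dim6 i)" for J1 J2 z1 z2
    unfolding dec dim6.simps by (intro kron_carrier basis_kernel_carrier)
  have swap: "?K J1 J2 (r1 *v z1) (r2 *v z2) * rho2 rho i r1 r2 = rho2 rho d r1 r2 * ?K J1 J2 z1 z2"
    if "J1 \<in> tri i1 o1" "J2 \<in> tri i2 o2" for J1 J2
    using that r1 r2
    by (simp only: dec rho2.simps kron_mult[OF basis_kernel_carrier basis_kernel_carrier rho_carrier rho_carrier]
        kron_mult[OF rho_carrier rho_carrier basis_kernel_carrier basis_kernel_carrier] basis_kernel_rotate)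
  have step: "?K J1 J2 (r1 *v z1) (r2 *v z2) *\<^sub>v (rho2 rho i r1 r2 *\<^sub>v w)
      = rho2 rho d r1 r2 *\<^sub>v (?K J1 J2 z1 z2 *\<^sub>v w)" if "J1 \<in> tri i1 o1" "J2 \<in> tri i2 o2" for J1 J2
    using swap[OF that] assoc_mult_mat_vec[OF K Ri w] assoc_mult_mat_vec[OF Rd K w] by metis
  have Kw: "?K J1 J2 z1 z2 *\<^sub>v w \<in> carrier_vec (dim6 d)" for J1 J2
    using K w by (rule mult_mat_vec_carrier)
  have w': "w \<in> carrier_vec (dim6 (i1, i2))"
    and Rw: "rho2 rho i r1 r2 *\<^sub>v w \<in> carrier_vec (dim6 (i1, i2))"
    using w Ri by (auto simp: dec simp del: dim6.simps)
  have "rho2 rho d r1 r2 *\<^sub>v (kernel6 sh CG phi d i z *\<^sub>v w)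
    = vsum (dim6 d) (\<lambda>J. rho2 rho d r1 r2 *\<^sub>v (case J of (J1, J2) \<Rightarrow>
        phi J1 J2 (norm z1) (norm z2) \<cdot>\<^sub>v (?K J1 J2 z1 z2 *\<^sub>v w))) (tri i1 o1 \<times> tri i2 o2)"
    unfolding dec kernel6_mult_vec[OF w'] unfolding dec[symmetric]
    by (intro mult_mat_vsum[OF Rd]) (use Kw in \<open>auto simp del: dim6.simps\<close>)
  also have "\<dots> = kernel6 sh CG phi d i (r1 *v fst z, r2 *v snd z) *\<^sub>v (rho2 rho i r1 r2 *\<^sub>v w)"
    unfolding dec fst_conv snd_conv kernel6_mult_vec[OF Rw[unfolded dec]] norm_rotation[OF r1] norm_rotation[OF r2]
    unfolding dec[symmetric]
    by (intro vsum_cong refl) (use Kw in \<open>auto simp: mult_mat_vec[OF Rd] step simp del: dim6.simps\<close>)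
  finally show ?thesis by simp
qed

end


section \<open>The projection onto the rotations\<close>

lemma orthogonal_matrix_row_sum:
  fixes M :: "real^3^3"
  assumes "orthogonal_matrix M"
  shows "(M$i$1)\<^sup>2 + (M$i$2)\<^sup>2 + (M$i$3)\<^sup>2 = 1"
proof -
  have "(M ** transpose M)$i$i = 1"
    using assms by (simp add: orthogonal_matrix_def Finite_Cartesian_Product.mat_def)
  then show ?thesis
    by (simp add: matrix_matrix_mult_def transpose_def sum_3 power2_eq_square)
qed

lemma orthogonal_matrix_col_sum:
  fixes M :: "real^3^3"
  assumes "orthogonal_matrix M"
  shows "(M$1$i)\<^sup>2 + (M$2$i)\<^sup>2 + (M$3$i)\<^sup>2 = 1"
  using orthogonal_matrix_row_sum[of "transpose M" i] assms
  by (simp only: orthogonal_matrix_transpose) (simp add: transpose_def)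

lemma orthogonal_matrix_diag_le_1:
  fixes M :: "real^3^3"
  assumes "orthogonal_matrix M"
  shows "M$i$i \<le> 1"
proof -
  have "(M$i$i)\<^sup>2 \<le> 1"
    using orthogonal_matrix_row_sum[OF assms, of i] exhaust_3[of i]
    by (smt (verit) zero_le_power2)
  then show ?thesis
    by (simp add: abs_square_le_1)
qed

text \<open>A rotation preserves cross products. Applied to pairs of basis vectors, this says that
  each diagonal entry equals its own cofactor.\<close>

lemma rotation_matrix_cofactors:
  fixes M :: "real^3^3"
  assumes "rotation_matrix M"
  shows "M$1$1 * M$2$2 = M$3$3 + M$1$2 * M$2$1"
    and "M$2$2 * M$3$3 = M$1$1 + M$2$3 * M$3$2"
    and "M$1$1 * M$3$3 = M$2$2 + M$1$3 * M$3$1"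
  using cross_rotation_matrix[OF assms, of "axis 1 1" "axis 2 1"]
    cross_rotation_matrix[OF assms, of "axis 2 1" "axis 3 1"]
    cross_rotation_matrix[OF assms, of "axis 3 1" "axis 1 1"]
  by (simp_all add: cross3_def Finite_Cartesian_Product.vec_eq_iff forall_3 matrix_vector_mult_def sum_3 axis_def algebra_simps)

text \<open>
  In terms of the unit quaternion \<open>w + xi + yj + zk\<close> of the rotation, the four numbers \<open>a, b, c, d\<close>
  of the proof are \<open>4x\<^sup>2, 4y\<^sup>2, 4z\<^sup>2, 4w\<^sup>2\<close>.
\<close>
lemma rotation_matrix_diag_le_1:
  fixes M :: "real^3^3"
  assumes "rotation_matrix M"
  shows "M$1$1 + M$2$2 - M$3$3 \<le> 1"
proof -
  have orth: "orthogonal_matrix M"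
    using assms by (simp add: rotation_matrix_def)
  note row = orthogonal_matrix_row_sum[OF orth] and col = orthogonal_matrix_col_sum[OF orth]
    and cof = rotation_matrix_cofactors[OF assms]
  define a where "a = 1 + M$1$1 - M$2$2 - M$3$3"
  define b where "b = 1 - M$1$1 + M$2$2 - M$3$3"
  define c where "c = 1 - M$1$1 - M$2$2 + M$3$3"
  define d where "d = 1 + M$1$1 + M$2$2 + M$3$3"
  \<comment> \<open>In each of the three products, the unit rows and columns account for the squares
    and one cofactor identity for the product of two diagonal entries.\<close>
  have "c * a = (M$1$3 + M$3$1)\<^sup>2"
    using row[of 1] row[of 3] col[of 2] cof(3) unfolding a_def c_def power2_eq_square
    by (simp add: algebra_simps)
  moreover have "c * b = (M$2$3 + M$3$2)\<^sup>2"
    using row[of 2] row[of 3] col[of 1] cof(2) unfolding b_def c_def power2_eq_square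
    by (simp add: algebra_simps)
  moreover have "c * d = (M$1$2 - M$2$1)\<^sup>2"
    using row[of 1] row[of 2] col[of 3] cof(1) unfolding d_def c_def power2_eq_square
    by (simp add: algebra_simps)
  ultimately have "c * (a + b + d) \<ge> 0"
    by (simp add: distrib_left)
  moreover have "a + b + d = 4 - c"
    by (simp add: a_def b_def c_def d_def)
  \<comment> \<open>Now \<open>c * (4 - c)\<close> is nonnegative, which excludes negative
    \<open>c\<close>.\<close>
  ultimately have "c \<ge> 0"
    by (auto simp: zero_le_mult_iff)
  then show ?thesis
    by (simp add: c_def)
qed

lemma diag3_nth [simp]:
  "diag3 a b c $ 1 $ 1 = a" "diag3 a b c $ 1 $ 2 = 0" "diag3 a b c $ 1 $ 3 = 0"
  "diag3 a b c $ 2 $ 1 = 0" "diag3 a b c $ 2 $ 2 = b" "diag3 a b c $ 2 $ 3 = 0"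
  "diag3 a b c $ 3 $ 1 = 0" "diag3 a b c $ 3 $ 2 = 0" "diag3 a b c $ 3 $ 3 = c"
  by (simp_all add: diag3_def)

lemma det_diag3 [simp]: "det (diag3 a b c) = a * b * c"
  by (simp add: det_3)

lemma transpose_diag3 [simp]: "transpose (diag3 a b c) = diag3 a b c"
  by (simp add: Finite_Cartesian_Product.vec_eq_iff forall_3 transpose_def)

lemma orthogonal_matrix_diag3:
  assumes "d = 1 \<or> d = -1"
  shows "orthogonal_matrix (diag3 1 1 d)"
  using assms
  by (auto simp: orthogonal_matrix Finite_Cartesian_Product.vec_eq_iff forall_3 matrix_matrix_mult_def sum_3 Finite_Cartesian_Product.mat_def)

lemma trace_mult_diag3:
  "trace (M ** diag3 a b c) = M$1$1 * a + M$2$2 * b + M$3$3 * c"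
  by (simp add: trace_def matrix_matrix_mult_def sum_3)


text \<open>Since the weights decrease, it suffices to bound the partial sums of the diagonal by
  \<open>1\<close>, \<open>2\<close> and \<open>2 + d\<close>, the values attained by
  \<open>diag3 1 1 d\<close>.\<close>

lemma weighted_diag_le:
  fixes M :: "real^3^3"
  assumes M: "orthogonal_matrix M" and d: "det M = d"
    and s: "s1 \<ge> s2" "s2 \<ge> s3" "s3 \<ge> 0"
  shows "M$1$1 * s1 + M$2$2 * s2 + M$3$3 * s3 \<le> s1 + s2 + d * s3"
    and "s2 > s3 \<Longrightarrow> M$1$1 * s1 + M$2$2 * s2 + M$3$3 * s3 = s1 + s2 + d * s3 \<Longrightarrow> M = diag3 1 1 d"
proof -
  have le: "M$1$1 \<le> 1" "M$2$2 \<le> 1"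
    using orthogonal_matrix_diag_le_1[OF M] by auto
  \<comment> \<open>For \<open>d = 1\<close> every diagonal entry is at most \<open>1\<close>. For
    \<open>d = -1\<close>, negating the third column gives a rotation, to which the quaternion bound
    applies.\<close>
  have tr: "M$1$1 + M$2$2 + M$3$3 \<le> 2 + d"
  proof (cases "d = 1")
    case True
    then show ?thesis
      using le orthogonal_matrix_diag_le_1[OF M, of 3] by simp
  next
    case False
    then have d': "d = -1"
      using det_orthogonal_matrix[OF M] d by auto
    have "rotation_matrix (M ** diag3 1 1 (-1))"
      using M d d' by (simp add: rotation_matrix_def orthogonal_matrix_mul orthogonal_matrix_diag3 det_mul)
    from rotation_matrix_diag_le_1[OF this] show ?thesis
      by (simp add: matrix_matrix_mult_def sum_3 d')
  qed
  \<comment> \<open>Summation by parts: successive differences of the weights multiply the slack in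
    the three partial sums.\<close>
  have gap: "s1 + s2 + d * s3 - (M$1$1 * s1 + M$2$2 * s2 + M$3$3 * s3) =
      (s1 - s2) * (1 - M$1$1) + (s2 - s3) * (2 - M$1$1 - M$2$2)
        + s3 * (2 + d - M$1$1 - M$2$2 - M$3$3)"
    by (simp add: algebra_simps)
  have nonneg: "(s1 - s2) * (1 - M$1$1) \<ge> 0" "(s2 - s3) * (2 - M$1$1 - M$2$2) \<ge> 0"
    "s3 * (2 + d - M$1$1 - M$2$2 - M$3$3) \<ge> 0"
    using le tr s by (auto intro!: mult_nonneg_nonneg)
  then show "M$1$1 * s1 + M$2$2 * s2 + M$3$3 * s3 \<le> s1 + s2 + d * s3"
    using gap by linarith
  assume "s2 > s3" and "M$1$1 * s1 + M$2$2 * s2 + M$3$3 * s3 = s1 + s2 + d * s3"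
  then have "(s2 - s3) * (2 - M$1$1 - M$2$2) = 0"
    using gap nonneg by linarith
  \<comment> \<open>Two entries bounded by \<open>1\<close> have sum \<open>2\<close>. The unit rows
    and columns then force the off-diagonal entries to vanish, and the determinant fixes the last
    entry.\<close>
  then have one: "M$1$1 = 1" "M$2$2 = 1"
    using \<open>s2 > s3\<close> le by auto
  then have zero: "M$1$2 = 0" "M$1$3 = 0" "M$2$1 = 0" "M$2$3 = 0" "M$3$1 = 0" "M$3$2 = 0"
    using orthogonal_matrix_row_sum[OF M, of 1] orthogonal_matrix_row_sum[OF M, of 2]
      orthogonal_matrix_col_sum[OF M, of 1] orthogonal_matrix_col_sum[OF M, of 2]
    by (auto simp: add_nonneg_eq_0_iff)
  then have "M$3$3 = d"
    using d one by (simp add: det_3)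
  then show "M = diag3 1 1 d"
    using one zero by (simp add: Finite_Cartesian_Product.vec_eq_iff forall_3)
qed

section \<open>The SVD projection as a maximiser of the trace\<close>

definition svd_rotation :: "real^3^3 \<Rightarrow> real^3^3 \<Rightarrow> real^3^3" where
  "svd_rotation U V = U ** diag3 1 1 (sgn (det (U ** transpose V))) ** transpose V"

lemma svd_sign:
  fixes U V :: "real^3^3"
  assumes "orthogonal_matrix U" "orthogonal_matrix V"
  shows "sgn (det (U ** transpose V)) = det U * det V"
  using det_orthogonal_matrix[OF assms(1)] det_orthogonal_matrix[OF assms(2)]
  by (auto simp: det_mul)

lemma rotation_svd_rotation:
  assumes "orthogonal_matrix U" "orthogonal_matrix V"
  shows "rotation_matrix (svd_rotation U V)"
  using det_orthogonal_matrix[OF assms(1)] det_orthogonal_matrix[OF assms(2)] assms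
  by (auto simp: rotation_matrix_def svd_rotation_def svd_sign[OF assms] det_mul
      intro!: orthogonal_matrix_mul orthogonal_matrix_diag3)

text \<open>By cyclicity, the trace is the diagonal of \<open>V^T W^T U\<close> weighted by the
  singular values. For every rotation \<open>W\<close> this orthogonal matrix has determinant
  \<open>det U * det V\<close>, and \<open>svd_rotation U V\<close> makes it the extremal matrix
  \<open>diag3 1 1 d\<close>.\<close>

lemma svd_rotation_maximal:
  assumes svd: "is_svd A U s1 s2 s3 V" and W: "rotation_matrix W"
  shows "trace (transpose W ** A) \<le> trace (transpose (svd_rotation U V) ** A)"
    and "s2 > s3 \<Longrightarrow> trace (transpose W ** A)
        = trace (transpose (svd_rotation U V) ** A) \<Longrightarrow> W = svd_rotation U V"
proof -
  have U: "orthogonal_matrix U" and V: "orthogonal_matrix V" and s: "s1 \<ge> s2" "s2 \<ge> s3" "s3 \<ge> 0"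
    and A: "A = U ** diag3 s1 s2 s3 ** transpose V"
    using svd by (auto simp: is_svd_def)
  define d where "d = det U * det V"
  define M where "M W = transpose V ** transpose W ** U" for W
  have orth: "orthogonal_matrix (M W)" and det: "det (M W) = d"
    using W U V by (auto simp: M_def d_def rotation_matrix_def det_mul intro!: orthogonal_matrix_mul)
  have tr: "trace (transpose W ** A) = M W$1$1 * s1 + M W$2$2 * s2 + M W$3$3 * s3" for W
  proof -
    have "trace (transpose W ** A) = trace (M W ** diag3 s1 s2 s3)"
      using trace_mul_sym[of "transpose V" "transpose W ** U ** diag3 s1 s2 s3"]
      by (simp add: A M_def matrix_mul_assoc)
    then show ?thesis
      by (simp add: trace_mult_diag3)
  qed
  have R: "svd_rotation U V = U ** diag3 1 1 d ** transpose V"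
    by (simp add: svd_rotation_def svd_sign[OF U V] d_def)
  have "M (svd_rotation U V) = (transpose V ** V) ** diag3 1 1 d ** (transpose U ** U)"
    by (simp add: M_def R matrix_transpose_mul matrix_mul_assoc)
  then have MR: "M (svd_rotation U V) = diag3 1 1 d"
    using U V by (simp add: orthogonal_matrix)
  show "trace (transpose W ** A) \<le> trace (transpose (svd_rotation U V) ** A)"
    using weighted_diag_le(1)[OF orth det s] by (simp add: tr MR)
  assume "s2 > s3" "trace (transpose W ** A) = trace (transpose (svd_rotation U V) ** A)"
  then have "M W = diag3 1 1 d"
    using weighted_diag_le(2)[OF orth det s] by (simp add: tr MR)
  \<comment> \<open>Conjugating back recovers \<open>W\<close> from \<open>M W\<close>, so
    uniqueness of the extremal matrix becomes uniqueness of the rotation.\<close>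
  moreover have "transpose W = V ** M W ** transpose U"
  proof -
    have "V ** M W ** transpose U = (V ** transpose V) ** transpose W ** (U ** transpose U)"
      by (simp add: M_def matrix_mul_assoc)
    then show ?thesis
      using U V by (simp add: orthogonal_matrix_def)
  qed
  ultimately have "transpose W = V ** diag3 1 1 d ** transpose U"
    by simp
  then have "transpose (transpose W) = U ** diag3 1 1 d ** transpose V"
    by (simp add: matrix_transpose_mul matrix_mul_assoc)
  then show "W = svd_rotation U V"
    by (simp add: R)
qed

text \<open>The rotation of any other decomposition also maximises the same trace, so both traces
  agree; uniqueness for the decomposition with a gap identifies the two rotations and determines the
  choice in \<open>svd_proj\<close>.\<close>

lemma svd_proj_eq:
  assumes svd: "is_svd A U s1 s2 s3 V" and gap: "s2 > s3"
  shows "svd_proj A = svd_rotation U V"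
  unfolding svd_proj_def svd_rotation_def[symmetric]
proof (rule some_equality)
  show "\<exists>U' s1 s2 s3 V'. is_svd A U' s1 s2 s3 V' \<and> svd_rotation U V = svd_rotation U' V'"
    using svd by blast
  fix R assume "\<exists>U s1 s2 s3 V. is_svd A U s1 s2 s3 V \<and> R = svd_rotation U V"
  then obtain U' t1 t2 t3 V' where svd': "is_svd A U' t1 t2 t3 V'" and R: "R = svd_rotation U' V'"
    by blast
  have rot: "rotation_matrix R" "rotation_matrix (svd_rotation U V)"
    using svd svd' by (auto simp: R is_svd_def intro!: rotation_svd_rotation)
  have "trace (transpose R ** A) = trace (transpose (svd_rotation U V) ** A)"
    using svd_rotation_maximal(1)[OF svd rot(1)] svd_rotation_maximal(1)[OF svd' rot(2)]
    by (simp add: R)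
  then show "R = svd_rotation U V"
    using svd_rotation_maximal(2)[OF svd rot(1) gap] by simp
qed

text \<open>Replacing \<open>U, V\<close> by \<open>r2 ** U, r1 ** V\<close> decomposes the
  transformed matrix with the same singular values, and the sign is unchanged because rotations have
  determinant \<open>1\<close>.\<close>

lemma svd_proj_bi_equivariant:
  assumes A: "singular_values A s1 s2 s3" and gap: "s2 > s3" and r: "r1 \<in> SO3" "r2 \<in> SO3"
  shows "svd_proj (r2 ** A ** transpose r1) = r2 ** svd_proj A ** transpose r1"
proof -
  obtain U V where svd: "is_svd A U s1 s2 s3 V"
    using A by (auto simp: singular_values_def)
  have r': "orthogonal_matrix r1" "orthogonal_matrix r2"
    "det r1 = 1" "det r2 = 1"
    using r by (auto simp: SO3_def rotation_matrix_def)
  have "is_svd (r2 ** A ** transpose r1) (r2 ** U) s1 s2 s3 (r1 ** V)"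
    using svd r' by (auto simp: is_svd_def orthogonal_matrix_mul matrix_transpose_mul matrix_mul_assoc)
  then have "svd_proj (r2 ** A ** transpose r1) = svd_rotation (r2 ** U) (r1 ** V)"
    using gap by (rule svd_proj_eq)
  also have "\<dots> = r2 ** svd_rotation U V ** transpose r1"
    using r' by (simp add: svd_rotation_def det_mul matrix_transpose_mul matrix_mul_assoc)
  finally show ?thesis
    using svd_proj_eq[OF svd gap] by simp
qed

text \<open>Undoing the orthogonal factors shows that the diagonal matrix is zero. This serves to
  exclude an empty set of key points.\<close>

lemma singular_values_zero:
  assumes "singular_values 0 s1 s2 s3"
  shows "s2 = 0"
proof -
  obtain U V where U: "orthogonal_matrix U" and V: "orthogonal_matrix V"
    and eq: "0 = U ** diag3 s1 s2 s3 ** transpose V"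
    using assms by (auto simp: singular_values_def is_svd_def)
  have "diag3 s1 s2 s3 = (transpose U ** U) ** diag3 s1 s2 s3 ** (transpose V ** V)"
    using U V by (simp add: orthogonal_matrix)
  also have "\<dots> = transpose U ** (U ** diag3 s1 s2 s3 ** transpose V) ** V"
    by (simp add: matrix_mul_assoc)
  also have "\<dots> = 0"
    by (simp flip: eq)
  finally have "diag3 s1 s2 s3 $ 2 $ 2 = 0" by simp
  then show ?thesis by simp
qed


section \<open>Equivariance of the layers\<close>

text \<open>A relation rather than an equation of fields, because values at invalid indices are
  arbitrary. It also records the dimensions of the features, which the linear algebra
  requires.\<close>

definition transports ::
    "('d \<Rightarrow> nat) \<Rightarrow> ('p \<Rightarrow> 'p) \<Rightarrow> ('d \<Rightarrow> real mat) \<Rightarrow> ('p, 'd) tfield \<Rightarrow> ('p, 'd) tfield \<Rightarrow> bool" where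
  "transports dm g D F F' \<longleftrightarrow> num F' = num F \<and> chan F' = chan F \<and>
     (\<forall>u<num F. pt F' u = g (pt F u)) \<and>
     (\<forall>u<num F. \<forall>d. \<forall>b<chan F d. feat F u d b \<in> carrier_vec (dm d) \<and>
        feat F' u d b = D d *\<^sub>v feat F u d b)"

text \<open>Covers the 3-D and 6-D layers at once. \<open>L\<close> is the linear part of the motion
  \<open>g\<close>: kernels see only differences of points, from which translations drop
  out.\<close>

locale equivariant_kernel =
  fixes dm :: "'d \<Rightarrow> nat"
    and ker :: "'r \<Rightarrow> 'd \<Rightarrow> 'd \<Rightarrow> 'p::real_normed_vector \<Rightarrow> real mat"
    and g L :: "'p \<Rightarrow> 'p"
    and D :: "'d \<Rightarrow> real mat"
  assumes D_carrier: "D d \<in> carrier_mat (dm d) (dm d)"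
    and D_transpose_mult: "transpose_mat (D d) * D d = 1\<^sub>m (dm d)"
    and g_diff: "g x - g y = L (x - y)"
    and norm_L: "norm (L x) = norm x"
    and ker_carrier: "ker phi d i x \<in> carrier_mat (dm d) (dm i)"
    and ker_equivariant: "w \<in> carrier_vec (dm i) \<Longrightarrow>
      ker phi d i (L x) *\<^sub>v (D i *\<^sub>v w) = D d *\<^sub>v (ker phi d i x *\<^sub>v w)"
begin

abbreviation "transported \<equiv> transports dm g D"

lemma D_mult_carrier: "x \<in> carrier_vec (dm d) \<Longrightarrow> D d *\<^sub>v x \<in> carrier_vec (dm d)"
  using D_carrier by (rule mult_mat_vec_carrier)

lemma D_smult: "x \<in> carrier_vec (dm d) \<Longrightarrow> D d *\<^sub>v (c \<cdot>\<^sub>v x) = c \<cdot>\<^sub>v (D d *\<^sub>v x)"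
  using D_carrier by (rule mult_mat_vec)

lemma D_scalar_prod:
  assumes x: "x \<in> carrier_vec (dm d)" and y: "y \<in> carrier_vec (dm d)"
  shows "(D d *\<^sub>v x) \<bullet>v (D d *\<^sub>v y) = x \<bullet>v y"
proof -
  have "(D d *\<^sub>v x) \<bullet>v (D d *\<^sub>v y) = (transpose_mat (D d) *\<^sub>v (D d *\<^sub>v x)) \<bullet>v y"
    by (rule transpose_vec_mult_scalar[OF D_carrier y D_mult_carrier[OF x], symmetric])
  also have "transpose_mat (D d) *\<^sub>v (D d *\<^sub>v x) = (transpose_mat (D d) * D d) *\<^sub>v x"
    using D_carrier x by (intro assoc_mult_mat_vec[symmetric]) auto
  finally show ?thesis
    using x by (simp add: D_transpose_mult)
qed

lemma mix_carrier: "mix dm w F u d \<in> carrier_vec (dm d)"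
  by (simp add: mix_def)

lemma mix_transported:
  assumes "transported F F'" "u < num F"
  shows "mix dm w F' u d = D d *\<^sub>v mix dm w F u d"
  using assms unfolding mix_def
  by (subst mult_mat_vsum[OF D_carrier]) (auto simp: transports_def D_smult intro!: vsum_cong)

lemma message_carrier: "message dm ker phi F d u v \<in> carrier_vec (dm d)"
  by (simp add: message_def)

lemma message_transported:
  assumes F: "transported F F'" and u: "u < num F" and v: "v < num F"
  shows "message dm ker phi F' d u v = D d *\<^sub>v message dm ker phi F d u v"
proof -
  have "message dm ker phi F' d u v = vsum (dm d) (\<lambda>x. D d *\<^sub>v
      (case x of (i, b) \<Rightarrow> ker (phi i b) d i (pt F v - pt F u) *\<^sub>v feat F v i b))
      (SIGMA i:degs (chan F). {..<chan F i})"
    unfolding message_def using F u v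
    by (intro vsum_cong) (auto simp: transports_def g_diff ker_equivariant)
  also have "\<dots> = D d *\<^sub>v message dm ker phi F d u v"
    unfolding message_def using F v
    by (intro mult_mat_vsum[symmetric] D_carrier)
      (auto simp: transports_def intro!: mult_mat_vec_carrier[OF ker_carrier])
  finally show ?thesis .
qed

text \<open>In each degree, query and key are multiplied by the same orthogonal matrix, which
  preserves their inner product.\<close>

lemma logit_transported:
  assumes "transported F F'" "u < num F" "v < num F"
  shows "logit dm ker WQ phiK F' u v = logit dm ker WQ phiK F u v"
proof -
  have "chan F' = chan F"
    using assms by (simp add: transports_def)
  then show ?thesis
    unfolding logit_def
    by (simp add: mix_transported[OF assms(1,2)] message_transported[OF assms]
        D_scalar_prod mix_carrier message_carrier)
qed

text \<open>The motion is an isometry, and the indices that break ties are kept.\<close>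

lemma knn_transported:
  assumes F: "transported F F'" and u: "u < num F"
  shows "knn k (num F') (pt F') u = knn k (num F) (pt F) u"
proof -
  have "dist (pt F' w) (pt F' u) = dist (pt F w) (pt F u)" if "w < num F" for w
    using F u that by (simp add: transports_def dist_norm g_diff norm_L)
  moreover have "num F' = num F"
    using F by (simp add: transports_def)
  ultimately show ?thesis
    unfolding knn_def by (auto cong: conj_cong)
qed

lemma elu_carrier:
  "x \<in> carrier_vec n \<Longrightarrow> y \<in> carrier_vec n \<Longrightarrow> elu x y \<in> carrier_vec n"
  by (simp add: elu_def Let_def)

text \<open>The inner product and the norm are invariant, so both sides take the same branch with
  the same coefficient; what remains is linear.\<close>

lemma elu_transported:
  assumes x: "x \<in> carrier_vec (dm d)" and y: "y \<in> carrier_vec (dm d)"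
  shows "elu (D d *\<^sub>v x) (D d *\<^sub>v y) = D d *\<^sub>v elu x y"
proof -
  let ?e = "(1 / vnorm y) \<cdot>\<^sub>v y"
  have e: "?e \<in> carrier_vec (dm d)"
    using y by simp
  have "(1 / vnorm (D d *\<^sub>v y)) \<cdot>\<^sub>v (D d *\<^sub>v y) = D d *\<^sub>v ?e"
    using y by (simp add: vnorm_def D_scalar_prod D_smult)
  moreover have "D d *\<^sub>v (x - (x \<bullet>v ?e) \<cdot>\<^sub>v ?e) = D d *\<^sub>v x - (x \<bullet>v ?e) \<cdot>\<^sub>v (D d *\<^sub>v ?e)"
    using mult_minus_distrib_mat_vec[OF D_carrier x, of "(x \<bullet>v ?e) \<cdot>\<^sub>v ?e"] e D_smult[OF e] by simp
  ultimately show ?thesis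
    using x y e by (simp add: elu_def Let_def D_scalar_prod)
qed

lemma apply_layer_transported:
  assumes F: "transported F F'"
  shows "transported (apply_layer dm ker l F) (apply_layer dm ker l F')"
proof (cases l)
  case (Attention k c W WQ phiK phiV)
  have eqs: "num F' = num F" "\<And>u. u < num F \<Longrightarrow> pt F' u = g (pt F u)"
    using F by (auto simp: transports_def)
  define alpha where "alpha G u v = exp (logit dm ker WQ phiK G u v) /
      (\<Sum>v'\<in>knn k (num G) (pt G) u - {u}. exp (logit dm ker WQ phiK G u v'))" for G u v
  define summand where "summand G u d a = (\<lambda>v. alpha G u v \<cdot>\<^sub>v message dm ker (\<lambda>i b. phiV d i a b) G d u v)"
    for G u d a
  have feat: "feat (apply_layer dm ker l G) u d a = mix dm (W d a) G u d +
      vsum (dm d) (summand G u d a) (knn k (num G) (pt G) u - {u})" for G u d a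
    by (simp add: Attention summand_def alpha_def Let_def)
  \<comment> \<open>Proved for all degrees and channels, hence also for the new channel numbers
    \<open>c\<close>. The attention weights are invariant, so the update is a fixed linear
    combination of equivariant messages.\<close>
  have "feat (apply_layer dm ker l F') u d a = D d *\<^sub>v feat (apply_layer dm ker l F) u d a"
    if u: "u < num F" for u d a
  proof -
    note nb = knn_transported[OF F u]
    have lt: "v < num F" if "v \<in> knn k (num F) (pt F) u" for v
      using that by (simp add: knn_def)
    have "(\<Sum>v\<in>knn k (num F) (pt F) u - {u}. exp (logit dm ker WQ phiK F' u v))
        = (\<Sum>v\<in>knn k (num F) (pt F) u - {u}. exp (logit dm ker WQ phiK F u v))"
      by (intro sum.cong refl) (auto simp: logit_transported[OF F u] lt)
    then have "alpha F' u v = alpha F u v" if "v \<in> knn k (num F) (pt F) u" for v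
      using that by (simp add: alpha_def nb logit_transported[OF F u] lt)
    then have summand: "summand F' u d a v = D d *\<^sub>v summand F u d a v" if "v \<in> knn k (num F) (pt F) u" for v
      using that by (simp add: summand_def message_transported[OF F u] lt D_smult message_carrier)
    have "vsum (dm d) (summand F' u d a) (knn k (num F') (pt F') u - {u})
        = vsum (dm d) (\<lambda>v. D d *\<^sub>v summand F u d a v) (knn k (num F) (pt F) u - {u})"
      by (intro vsum_cong) (auto simp: nb summand)
    also have "\<dots> = D d *\<^sub>v vsum (dm d) (summand F u d a) (knn k (num F) (pt F) u - {u})"
      by (intro mult_mat_vsum[symmetric] D_carrier) (simp add: summand_def message_carrier)
    finally show ?thesis
      unfolding feat mix_transported[OF F u]
      by (simp add: mult_add_distrib_mat_vec[OF D_carrier mix_carrier vsum_carrier])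
  qed
  moreover have "feat (apply_layer dm ker l F) u d a \<in> carrier_vec (dm d)" for u d a
    unfolding feat by (simp add: mix_carrier)
  ultimately show ?thesis
    using eqs unfolding transports_def by (simp add: Attention Let_def)
next
  case (Elu Wmu Wnu)
  then show ?thesis
    using F by (auto simp: transports_def mix_transported[OF F] elu_transported mix_carrier elu_carrier)
qed

lemma transformer_transported:
  "transported F F' \<Longrightarrow> transported (transformer dm ker ls F) (transformer dm ker ls F')"
  unfolding transformer_def
  by (induction ls arbitrary: F F') (simp_all add: apply_layer_transported)

end

section \<open>Points and channel numbers under layers\<close>

lemma apply_layer_num [simp]: "num (apply_layer dm ker l F) = num F"
  and apply_layer_pt [simp]: "pt (apply_layer dm ker l F) = pt F"
  and apply_layer_chan [simp]: "chan (apply_layer dm ker l F) = out_chan l (chan F)"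
  by (cases l; simp add: Let_def)+

lemma transformer_num [simp]: "num (transformer dm ker ls F) = num F"
  and transformer_pt [simp]: "pt (transformer dm ker ls F) = pt F"
  and transformer_chan [simp]: "chan (transformer dm ker ls F) = fold out_chan ls (chan F)"
  unfolding transformer_def by (induction ls arbitrary: F) simp_all


section \<open>Bi-equivariance of BITR\<close>

lemma coord_less: "coord i < 3"
  by (simp add: coord_def)

lemma coord_simps [simp]: "coord 1 = 0" "coord 2 = 1" "coord 3 = 2"
  by (simp_all add: coord_def)

lemma sum_coord: "(\<Sum>k<3. f k) = (\<Sum>i\<in>UNIV. f (coord i))"
  by (simp add: sum_3 numeral_3_eq_3 numeral_2_eq_2)

lemma to_R33_mult:
  assumes "A \<in> carrier_mat 3 3" "B \<in> carrier_mat 3 3"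
  shows "to_R33 (A * B) = to_R33 A ** to_R33 B"
  by (simp add: Finite_Cartesian_Product.vec_eq_iff to_R33_def matrix_matrix_mult_def
      mult_mat_entry[OF assms coord_less coord_less] sum_coord)

lemma to_R33_transpose:
  assumes "A \<in> carrier_mat 3 3"
  shows "to_R33 (transpose_mat A) = transpose (to_R33 A)"
  using assms by (simp add: Finite_Cartesian_Product.vec_eq_iff to_R33_def transpose_def coord_less)

lemma to_R3_mult_vec:
  assumes "A \<in> carrier_mat 3 3" "v \<in> carrier_vec 3"
  shows "to_R3 (A *\<^sub>v v) = to_R33 A *v to_R3 v"
  by (simp add: Finite_Cartesian_Product.vec_eq_iff to_R3_def to_R33_def matrix_vector_mult_def
      mult_mat_vec_entry[OF assms coord_less] sum_coord)

lemma kron_one_right: "kron A (1\<^sub>m 1) = A"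
  by (rule eq_matI) (auto simp: kron_def)

lemma kron_one_left: "kron (1\<^sub>m 1) A = A"
  by (rule eq_matI) (auto simp: kron_def)

text \<open>\<open>matrix_inv\<close> is a choice among two-sided inverses, so uniqueness of the
  inverse has to be shown.\<close>

lemma matrix_inv_rotation:
  assumes "r \<in> SO3"
  shows "matrix_inv r = transpose r"
  unfolding matrix_inv_def
proof (rule some_equality)
  fix s assume s: "r ** s = Finite_Cartesian_Product.mat 1 \<and> s ** r = Finite_Cartesian_Product.mat 1"
  have "s = (transpose r ** r) ** s"
    by (simp add: rotation_inverse[OF assms])
  also have "\<dots> = transpose r ** (r ** s)"
    by (simp add: matrix_mul_assoc)
  finally show "s = transpose r"
    using s by simp
qed (simp add: rotation_inverse[OF assms])

text \<open>With total weight \<open>1\<close> the translation is picked up exactly once. Softmax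
  averages and means are of this kind.\<close>

lemma move_convex_combination:
  assumes "(\<Sum>j\<in>A. w j) = 1"
  shows "(\<Sum>j\<in>A. w j *\<^sub>R move g (x j)) = move g (\<Sum>j\<in>A. w j *\<^sub>R x j)"
proof (cases g)
  case (Pair r t)
  have "(\<Sum>j\<in>A. w j *\<^sub>R move g (x j)) = (\<Sum>j\<in>A. r *v (w j *\<^sub>R x j)) + (\<Sum>j\<in>A. w j) *\<^sub>R t"
    by (simp add: Pair scaleR_right_distrib sum.distrib matrix_vector_mult_scaleR scaleR_sum_left)
  also have "(\<Sum>j\<in>A. r *v (w j *\<^sub>R x j)) = r *v (\<Sum>j\<in>A. w j *\<^sub>R x j)"
    by (rule linear_sum[OF matrix_vector_mul_linear, symmetric])
  finally show ?thesis
    using assms by (simp add: Pair)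
qed

text \<open>For \<open>N = 0\<close> division by zero would make both means \<open>0\<close>, and
  the translation would be lost.\<close>

lemma mean_move:
  assumes "N > 0"
  shows "mean N (\<lambda>u. move g (x u)) = move g (mean N x)"
  using move_convex_combination[where A = "{..<N}" and w = "\<lambda>_. 1 / real N" and g = g and x = x] assms
  by (simp add: mean_def scaleR_sum_right inverse_eq_divide)

section \<open>Equivariance of the stages of BITR\<close>

context steerable_basis
begin

abbreviation "transports3 g \<equiv> transports dim3 (move g) (\<lambda>p. rho p (fst g))"

abbreviation "transports6 g1 g2 \<equiv>
  transports dim6 (map_prod (move g1) (move g2)) (\<lambda>d. rho2 rho d (fst g1) (fst g2))"

lemma equivariant_kernel3:
  assumes "g \<in> SE3"
  shows "equivariant_kernel dim3 (kernel3 sh CG) (move g) ((*v) (fst g)) (\<lambda>p. rho p (fst g))"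
proof -
  have r: "fst g \<in> SO3"
    using assms by (auto simp: SE3_def)
  show ?thesis
  proof
    show "move g x - move g y = fst g *v (x - y)" for x y
      by (cases g) (simp add: matrix_vector_mult_diff_distrib)
    show "kernel3 sh CG phi d i x \<in> carrier_mat (dim3 d) (dim3 i)" for phi d i x
      by (simp add: kernel3_def)
  qed (use rho_carrier[OF r] rho_transpose_mult[OF r] norm_rotation[OF r] kernel3_rotate[OF r] in auto)
qed

lemma equivariant_kernel6:
  assumes "g1 \<in> SE3" "g2 \<in> SE3"
  shows "equivariant_kernel dim6 (kernel6 sh CG) (map_prod (move g1) (move g2))
    (map_prod ((*v) (fst g1)) ((*v) (fst g2))) (\<lambda>d. rho2 rho d (fst g1) (fst g2))"
proof -
  have r: "fst g1 \<in> SO3" "fst g2 \<in> SO3"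
    using assms by (auto simp: SE3_def)
  show ?thesis
  proof
    show "map_prod (move g1) (move g2) x - map_prod (move g1) (move g2) y
        = map_prod ((*v) (fst g1)) ((*v) (fst g2)) (x - y)" for x y
      by (cases g1; cases g2; cases x; cases y) (simp add: matrix_vector_mult_diff_distrib)
    show "norm (map_prod ((*v) (fst g1)) ((*v) (fst g2)) x) = norm x" for x
      by (cases x) (simp add: norm_Pair norm_rotation r)
    show "kernel6 sh CG phi d i x \<in> carrier_mat (dim6 d) (dim6 i)" for phi d i x
      by (simp add: kernel6_def)
    show "kernel6 sh CG phi d i (map_prod ((*v) (fst g1)) ((*v) (fst g2)) x) *\<^sub>v
        (rho2 rho i (fst g1) (fst g2) *\<^sub>v w)
        = rho2 rho d (fst g1) (fst g2) *\<^sub>v (kernel6 sh CG phi d i x *\<^sub>v w)"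
      if "w \<in> carrier_vec (dim6 i)" for phi d i x w
      using kernel6_rotate[OF r that, of phi d x] by (cases x) (simp only: map_prod_simp fst_conv snd_conv)
  qed (use rho2_carrier[OF r] rho2_transpose_mult[OF r] in auto)
qed

lemma act_cloud_transports3: "well_formed dim3 X \<Longrightarrow> transports3 g X (act_cloud rho g X)"
  by (auto simp: transports_def act_cloud_def well_formed_def)

lemma transports3_degree_0:
  assumes g: "g \<in> SE3" and F: "transports3 g F F'" and u: "u < num F" "b < chan F 0"
  shows "feat F u 0 b \<in> carrier_vec 1" "feat F' u 0 b = feat F u 0 b"
proof -
  have "feat F u 0 b \<in> carrier_vec (dim3 0)" "feat F' u 0 b = rho 0 (fst g) *\<^sub>v feat F u 0 b"
    using F u unfolding transports_def by blast+
  moreover from this(1) show "feat F u 0 b \<in> carrier_vec 1"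
    by simp
  moreover have "fst g \<in> SO3"
    using g by (auto simp: SE3_def)
  ultimately show "feat F' u 0 b = feat F u 0 b"
    by (simp only: rho_0 one_mult_mat_vec)
qed

text \<open>The other cloud enters only through pooled degree-0 features. These are invariant under
  \<open>g2\<close>, and \<open>g1\<close> acts on them trivially too, so the fused field follows
  \<open>g1\<close> alone.\<close>

lemma fuse_transports3:
  assumes g: "g1 \<in> SE3" "g2 \<in> SE3"
    and F: "transports3 g1 F F'" and G: "transports3 g2 G G'"
  shows "transports3 g1 (fuse F G) (fuse F' G')"
proof -
  have r: "fst g1 \<in> SO3"
    using g by (auto simp: SE3_def)
  have pool: "pool 1 (num G') (\<lambda>v. feat G' v 0 b) = pool 1 (num G) (\<lambda>v. feat G v 0 b)"
    if "b < chan G 0" for b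
    using G that transports3_degree_0(2)[OF g(2) G]
    by (intro pool_cong) (simp_all add: transports_def)
  have pool_invariant: "pool 1 n h \<in> carrier_vec (dim3 0)"
    "pool 1 n h = rho 0 (fst g1) *\<^sub>v pool 1 n h" for n h
    by (simp, simp only: rho_0[OF r] one_mult_mat_vec[OF pool_carrier])
  have "feat (fuse F G) u p b \<in> carrier_vec (dim3 p) \<and>
      feat (fuse F' G') u p b = rho p (fst g1) *\<^sub>v feat (fuse F G) u p b"
    if u: "u < num F" and b: "b < fuse_chan (chan F) (chan G) p" for u p b
  proof (cases "p = 0 \<and> b \<ge> chan F 0")
    case True
    then have "b - chan F 0 < chan G 0"
      using b by (auto simp: fuse_chan_def)
    then show ?thesis
      using True F pool pool_invariant by (simp add: fuse_def transports_def)
  next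
    case False
    then have "b < chan F p"
      using b by (auto simp: fuse_chan_def split: if_splits)
    then show ?thesis
      using False F u by (auto simp: fuse_def transports_def)
  qed
  then show ?thesis
    using F G by (simp add: transports_def fuse_def)
qed

lemma encode_transports3:
  assumes g: "g1 \<in> SE3" "g2 \<in> SE3" and X: "valid_input B X" and Y: "valid_input B Y"
  shows "transports3 g1 (encode sh CG B X Y) (encode sh CG B (act_cloud rho g1 X) (act_cloud rho g2 Y))"
  using X Y unfolding encode_def valid_input_def
  by (intro equivariant_kernel.apply_layer_transported[OF equivariant_kernel3] fuse_transports3[OF g]
      equivariant_kernel.transformer_transported[OF equivariant_kernel3] act_cloud_transports3 g) auto

text \<open>The softmax weights come from invariant degree-0 features. A nonempty cloud makes their
  denominator positive, so they sum to \<open>1\<close> and the key point is an affine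
  combination.\<close>

lemma key_point_transports3:
  assumes g: "g \<in> SE3" and E: "transports3 g E E'" and u: "u < chan E 0" and n: "num E > 0"
  shows "key_point E' u = move g (key_point E u)"
proof -
  let ?s = "\<lambda>j. feat E j 0 u $v 0"
  let ?w = "\<lambda>j. exp (?s j) / (\<Sum>j'<num E. exp (?s j'))"
  have "feat E' j 0 u = feat E j 0 u" if "j < num E" for j
    using transports3_degree_0(2)[OF g E that u] .
  then have "key_point E' u = (\<Sum>j<num E. ?w j *\<^sub>R move g (pt E j))"
    using E by (simp add: key_point_def Let_def transports_def cong: sum.cong_simp)
  also have "\<dots> = move g (\<Sum>j<num E. ?w j *\<^sub>R pt E j)"
  proof (rule move_convex_combination)
    have "(\<Sum>j<num E. exp (?s j)) > 0"
      using n by (intro sum_pos) auto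
    then show "(\<Sum>j<num E. ?w j) = 1"
      by (simp flip: sum_divide_distrib)
  qed
  finally show ?thesis
    by (simp add: key_point_def Let_def)
qed

lemma encode_chan_num:
  assumes "is_bitr rho B" "valid_input B X" "valid_input B Y"
  shows "chan (encode sh CG B X Y) 0 = nkeys B" "num (encode sh CG B X Y) > 0"
  using assms by (simp_all add: encode_def is_bitr_def valid_input_def fuse_def Let_def)

lemma Phi_S_transports6:
  assumes g: "g1 \<in> SE3" "g2 \<in> SE3" and B: "is_bitr rho B"
    and X: "valid_input B X" and Y: "valid_input B Y"
  shows "transports6 g1 g2 (Phi_S sh CG B X Y) (Phi_S sh CG B (act_cloud rho g1 X) (act_cloud rho g2 Y))"
  unfolding Phi_S_def
proof (intro equivariant_kernel.transformer_transported[OF equivariant_kernel6] g)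
  \<comment> \<open>The key points of the second cloud come from the encoder with the clouds
    exchanged, so there \<open>g2\<close> takes the place of \<open>g1\<close>.\<close>
  have "key_point (encode sh CG B (act_cloud rho g1 X) (act_cloud rho g2 Y)) u
      = move g1 (key_point (encode sh CG B X Y) u)"
    "key_point (encode sh CG B (act_cloud rho g2 Y) (act_cloud rho g1 X)) u
      = move g2 (key_point (encode sh CG B Y X) u)" if "u < nkeys B" for u
    using that encode_chan_num[OF B X Y] encode_chan_num[OF B Y X]
    by (auto intro!: key_point_transports3 encode_transports3 g X Y)
  moreover have "key_feat B X Y u d b \<in> carrier_vec (dim6 d) \<and>
      key_feat B (act_cloud rho g1 X) (act_cloud rho g2 Y) u d b
        = rho2 rho d (fst g1) (fst g2) *\<^sub>v key_feat B X Y u d b"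
    if "u < nkeys B" "b < key_chan B d" for u d b
    using B X Y g that unfolding is_bitr_def by blast
  ultimately show "transports6 g1 g2
    \<lparr>num = nkeys B, pt = \<lambda>u. (key_point (encode sh CG B X Y) u, key_point (encode sh CG B Y X) u),
     chan = key_chan B, feat = key_feat B X Y\<rparr>
    \<lparr>num = nkeys B,
     pt = \<lambda>u. (key_point (encode sh CG B (act_cloud rho g1 X) (act_cloud rho g2 Y)) u,
                key_point (encode sh CG B (act_cloud rho g2 Y) (act_cloud rho g1 X)) u),
     chan = key_chan B, feat = key_feat B (act_cloud rho g1 X) (act_cloud rho g2 Y)\<rparr>"
    by (simp add: transports_def)
qed

lemma pool_transports6:
  assumes g: "g1 \<in> SE3" "g2 \<in> SE3" and f: "transports6 g1 g2 f f'" and b: "b < chan f d"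
  shows "pool (dim6 d) (num f') (\<lambda>u. feat f' u d b)
    = rho2 rho d (fst g1) (fst g2) *\<^sub>v pool (dim6 d) (num f) (\<lambda>u. feat f u d b)"
proof -
  have r: "fst g1 \<in> SO3" "fst g2 \<in> SO3"
    using g by (auto simp: SE3_def)
  show ?thesis
    using f b
    by (subst mult_mat_pool[OF rho2_carrier[OF r]]) (auto simp: transports_def simp del: split_paired_All dim6.simps intro!: pool_cong)
qed

text \<open>The pooled features \<open>tX, tY\<close> only rotate, while the means also translate.
  In the new translation \<open>r1\<close> cancels against the transpose in the new rotation,
  leaving \<open>r2 t + t2 - r2 r r1^T t1\<close>, the translation part of
  \<open>g2 (r, t) g1^-1\<close>.\<close>

lemma Phi_P_bi_equivariant:
  assumes g: "g1 \<in> SE3" "g2 \<in> SE3" and f: "transports6 g1 g2 f f'" and n: "num f > 0"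
    and chan: "chan f (1, 1) > 0" "chan f (1, 0) > 0" "chan f (0, 1) > 0"
    and sv: "singular_values (r_hat f) s1 s2 s3" and gap: "s2 > s3"
  shows "Phi_P f' = se3_mult (se3_mult g2 (Phi_P f)) (se3_inv g1)"
proof -
  obtain r1 t1 r2 t2 where dec: "g1 = (r1, t1)" "g2 = (r2, t2)"
    by (metis surj_pair)
  then have r: "r1 \<in> SO3" "r2 \<in> SO3"
    using g by (auto simp: SE3_def)
  have num: "num f' = num f"
    using f by (simp add: transports_def)
  have rho1: "rho 1 r1 \<in> carrier_mat 3 3" "rho 1 r2 \<in> carrier_mat 3 3"
    using rho_carrier[OF r(1), of 1] rho_carrier[OF r(2), of 1] by simp_all
  have "pool 9 (num f') (\<lambda>u. feat f' u (1, 1) 0)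
      = kron (rho 1 r1) (rho 1 r2) *\<^sub>v pool 9 (num f) (\<lambda>u. feat f u (1, 1) 0)"
    using pool_transports6[OF g f chan(1)] by (simp add: dec)
  moreover have "pool 9 (num f) (\<lambda>u. feat f u (1, 1) 0) \<in> carrier_vec (3 * 3)"
    by simp
  \<comment> \<open>On column-stacked matrices, \<open>kron (rho 1 r1) (rho 1 r2)\<close> multiplies
    by \<open>r2\<close> on the left and by the transpose of \<open>r1\<close> on the right.\<close>
  ultimately have "r_hat f' = to_R33 (rho 1 r2 * unvec 3 3 (pool 9 (num f) (\<lambda>u. feat f u (1, 1) 0))
      * transpose_mat (rho 1 r1))"
    by (simp only: r_hat_def unvec_kron[OF rho1])
  also have "\<dots> = r2 ** r_hat f ** transpose r1"
    using rho1 by (simp add: to_R33_mult to_R33_transpose rho_1[OF r(1), simplified] rho_1[OF r(2), simplified] r_hat_def)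
  finally have R: "svd_proj (r_hat f') = r2 ** svd_proj (r_hat f) ** transpose r1"
    using svd_proj_bi_equivariant[OF sv gap r] by simp
  have "pool 3 (num f') (\<lambda>u. feat f' u (1, 0) 0) = rho 1 r1 *\<^sub>v pool 3 (num f) (\<lambda>u. feat f u (1, 0) 0)"
    using pool_transports6[OF g f chan(2)] rho_0[OF r(2)] by (simp add: dec kron_one_right[simplified])
  then have tX: "to_R3 (pool 3 (num f') (\<lambda>u. feat f' u (1, 0) 0))
      = r1 *v to_R3 (pool 3 (num f) (\<lambda>u. feat f u (1, 0) 0))"
    by (simp only: to_R3_mult_vec[OF rho1(1) pool_carrier] rho_1[OF r(1)])
  have "pool 3 (num f') (\<lambda>u. feat f' u (0, 1) 0) = rho 1 r2 *\<^sub>v pool 3 (num f) (\<lambda>u. feat f u (0, 1) 0)"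
    using pool_transports6[OF g f chan(3)] rho_0[OF r(1)] by (simp add: dec kron_one_left[simplified])
  then have tY: "to_R3 (pool 3 (num f') (\<lambda>u. feat f' u (0, 1) 0))
      = r2 *v to_R3 (pool 3 (num f) (\<lambda>u. feat f u (0, 1) 0))"
    by (simp only: to_R3_mult_vec[OF rho1(2) pool_carrier] rho_1[OF r(2)])
  have "mean (num f') (\<lambda>u. fst (pt f' u)) = mean (num f) (\<lambda>u. move g1 (fst (pt f u)))"
    "mean (num f') (\<lambda>u. snd (pt f' u)) = mean (num f) (\<lambda>u. move g2 (snd (pt f u)))"
    using f by (simp_all add: mean_def transports_def)
  then have mX: "mean (num f') (\<lambda>u. fst (pt f' u)) = r1 *v mean (num f) (\<lambda>u. fst (pt f u)) + t1"
    and mY: "mean (num f') (\<lambda>u. snd (pt f' u)) = r2 *v mean (num f) (\<lambda>u. snd (pt f u)) + t2"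
    by (simp_all only: mean_move[OF n]) (simp_all add: dec)
  have cancel: "r2 ** S ** transpose r1 ** r1 = r2 ** S" for S
    by (simp add: rotation_inverse[OF r(1)] flip: matrix_mul_assoc)
  have neg: "A *v (- x) = - (A *v x)" for A :: "real^3^3" and x
    by (rule linear_neg[OF matrix_vector_mul_linear])
  show ?thesis
    unfolding Phi_P_def Let_def R tX tY mX mY
    by (simp add: dec matrix_inv_rotation[OF r(1)] matrix_vector_right_distrib
        matrix_vector_mult_diff_distrib matrix_vector_mul_assoc matrix_mul_assoc cancel
        neg algebra_simps del: transpose_matrix_vector)
qed

end

text \<open>The pooled sum is empty and its prefactor \<open>1 / 0\<close> is
  \<open>0\<close>.\<close>

lemma r_hat_no_points:
  assumes "num f = 0"
  shows "r_hat f = 0"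
  using assms coord_less
  by (simp add: Finite_Cartesian_Product.vec_eq_iff r_hat_def to_R33_def unvec_def pool_def vsum_def coord_def)

theorem proposition4p1:
  fixes rho :: "nat \<Rightarrow> real^3^3 \<Rightarrow> real mat"
    and sh :: "nat \<Rightarrow> real^3 \<Rightarrow> real vec"
    and CG :: "nat \<Rightarrow> nat \<Rightarrow> nat \<Rightarrow> real mat"
    and B :: bitr and X Y :: cloud and s1 s2 s3 :: real
  assumes "SO3_irreps rho" and "spherical_harmonics rho sh" and "clebsch_gordan rho CG"
    and "is_bitr rho B"
    and "valid_input B X" and "valid_input B Y"
    and "singular_values (r_hat (Phi_S sh CG B X Y)) s1 s2 s3"
    and "s1 \<ge> s2" and "s2 > s3" and "s3 \<ge> 0"
  shows "\<forall>g1\<in>SE3. \<forall>g2\<in>SE3.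
           Phi_B sh CG B (act_cloud rho g1 X) (act_cloud rho g2 Y) =
             se3_mult (se3_mult g2 (Phi_B sh CG B X Y)) (se3_inv g1)"
proof (intro ballI)
  fix g1 g2 assume g: "g1 \<in> SE3" "g2 \<in> SE3"
  interpret steerable_basis rho sh CG
    using assms(1-3) by unfold_locales
  let ?f = "Phi_S sh CG B X Y"
  have chan: "chan ?f = (\<lambda>d. if d \<in> {(1, 1), (1, 0), (0, 1)} then 1 else 0)"
    using assms(4) by (simp add: Phi_S_def is_bitr_def)
  \<comment> \<open>Without key points the projected matrix would be zero and so
    \<open>s2 = 0\<close>, contradicting \<open>s2 > s3 \<ge> 0\<close>.\<close>
  have "num ?f > 0"
  proof (rule ccontr)
    assume "\<not> num ?f > 0"
    then have "s2 = 0"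
      using assms(7) r_hat_no_points[of ?f] singular_values_zero[of s1 s2 s3] by simp
    then show False
      using assms(9,10) by simp
  qed
  then show "Phi_B sh CG B (act_cloud rho g1 X) (act_cloud rho g2 Y) =
      se3_mult (se3_mult g2 (Phi_B sh CG B X Y)) (se3_inv g1)"
    unfolding Phi_B_def
    by (intro Phi_P_bi_equivariant[OF g Phi_S_transports6[OF g assms(4-6)] _ _ _ _ assms(7,9)])
      (simp_all add: chan)
qed

end
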